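(* Let $n\ge 5$ and let $K\subset\mathbb{R}^n$ be an origin-symmetric convex body that can be written as a direct sum $K=A\oplus B$, where $\dim(A)\ge 1$ and $\dim(B)\ge 4$. Then $K$ is not an intersection body.
   Context: A convex body in $\mathbb{R}^n$ is a compact convex set with nonempty interior. $K=A\oplus B$ is a direct sum if $K=A+B=\{a+b:a\in A,b\in B\}$ with $A,B$ compact convex sets whose linear spans satisfy $\mathbb{R}^n=\mathrm{span}(A)\oplus\mathrm{span}(B)$; $\dim(A)=\dim\mathrm{span}(A)=j$ and $\dim(B)=\dim\mathrm{span}(B)=n-j$. Because the sum is direct, $A$ and $B$ inherit origin symmetry from $K$. For a star body $K$ with the origin in its interior, the radial function is $\rho_K(\xi)=\max\{a: a\xi\in K\}$, $\xi\in S^{n-1}$. The spherical Radon transform of a continuous function $g$ on $S^{n-1}$ is $Rg(\xi)=\int_{S^{n-1}\cap\xi^\perp} g(\theta)\,d\theta$. An origin-symmetric star body $K\subset\mathbb{R}^n$ is an intersection body if $\rho_K$ is the spherical Radon transform of an even non-negative finite Borel measure $\mu$ on $S^{n-1}$, i.e. $\int_{S^{n-1}}\rho_K(\xi)g(\xi)\,d\xi=\int_{S^{n-1}}Rg(\xi)\,d\mu(\xi)$ for every continuous function $g$ on $S^{n-1}$. *)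

theory Defs
  imports "HOL-Analysis.Analysis"
begin

definition convex_body :: "'a::euclidean_space set \<Rightarrow> bool" where
  "convex_body K \<longleftrightarrow> compact K \<and> convex K \<and> interior K \<noteq> {}"

definition origin_symmetric :: "'a::real_vector set \<Rightarrow> bool" where
  "origin_symmetric K \<longleftrightarrow> uminus ` K = K"

definition is_direct_sum :: "'a::euclidean_space set \<Rightarrow> 'a set \<Rightarrow> 'a set \<Rightarrow> bool" where
  "is_direct_sum K A B \<longleftrightarrow>
     compact A \<and> convex A \<and> compact B \<and> convex B \<and>
     K = {a + b | a b. a \<in> A \<and> b \<in> B} \<and>
     {u + v | u v. u \<in> span A \<and> v \<in> span B} = UNIV \<and>
     span A \<inter> span B = {0}"

definition radial :: "'a::real_vector set \<Rightarrow> 'a \<Rightarrow> real" where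
  "radial K \<xi> = (GREATEST a. a *\<^sub>R \<xi> \<in> K)"

definition star_body :: "'a::euclidean_space set \<Rightarrow> bool" where
  "star_body K \<longleftrightarrow>
     compact K \<and> 0 \<in> interior K \<and>
     (\<forall>x\<in>K. \<forall>t\<in>{0..1}. t *\<^sub>R x \<in> K) \<and>
     continuous_on (sphere 0 1) (radial K)"

text \<open>
  Lebesgue measure on a linear subspace \<open>V\<close>, built as the library builds \<open>lborel\<close> but over an
  orthonormal basis of \<open>V\<close>. By rotation invariance of product Lebesgue measure, the result does
  not depend on the basis chosen.
\<close>

definition subspace_onb :: "'a::euclidean_space set \<Rightarrow> 'a set" where
  "subspace_onb V = (SOME B. pairwise orthogonal B \<and> (\<forall>b\<in>B. norm b = 1) \<and> span B = V)"

definition subspace_lborel :: "'a::euclidean_space set \<Rightarrow> 'a measure" where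
  "subspace_lborel V =
     distr (\<Pi>\<^sub>M b\<in>subspace_onb V. lborel) (restrict_space borel V)
       (\<lambda>f. \<Sum>b\<in>subspace_onb V. f b *\<^sub>R b)"

text \<open>
  Surface measure on the unit sphere of a linear subspace \<open>V\<close> of dimension \<open>d\<close>, given by the
  cone formula: a Borel set \<open>E\<close> of unit vectors of \<open>V\<close> has measure \<open>d\<close> times the
  \<open>d\<close>-dimensional volume of the cone of all \<open>r *\<^sub>R \<theta>\<close> with \<open>0 < r \<le> 1\<close> and \<open>\<theta> \<in> E\<close>.
  The function \<open>sgn\<close> maps a nonzero vector \<open>x\<close> to \<open>x /\<^sub>R norm x\<close>. The measure space
  consists of the unit vectors of \<open>V\<close> only, so that functions which are continuous merely on
  the sphere are measurable.
\<close>

definition sphere_measure :: "'a::euclidean_space set \<Rightarrow> 'a measure" where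
  "sphere_measure V =
     scale_measure (of_nat (dim V))
       (distr (restrict_space (subspace_lborel V) (cball 0 1 - {0}))
          (restrict_space borel (sphere 0 1 \<inter> V)) sgn)"

definition spherical_radon :: "('a::euclidean_space \<Rightarrow> real) \<Rightarrow> 'a \<Rightarrow> real" where
  "spherical_radon g \<xi> = (LINT \<theta>|sphere_measure {x. \<xi> \<bullet> x = 0}. g \<theta>)"

definition even_measure :: "'a::real_vector measure \<Rightarrow> bool" where
  "even_measure \<mu> \<longleftrightarrow> (\<forall>E\<in>sets \<mu>. emeasure \<mu> (uminus ` E) = emeasure \<mu> E)"

definition intersection_body :: "'a::euclidean_space set \<Rightarrow> bool" where
  "intersection_body K \<longleftrightarrow>
     star_body K \<and> origin_symmetric K \<and>
     (\<exists>\<mu>. sets \<mu> = sets (restrict_space borel (sphere (0::'a) 1)) \<and>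
          finite_measure \<mu> \<and> even_measure \<mu> \<and>
          (\<forall>g. continuous_on (sphere 0 1) g \<longrightarrow>
             (LINT \<xi>|sphere_measure UNIV. radial K \<xi> * g \<xi>) =
             (LINT \<xi>|\<mu>. spherical_radon g \<xi>)))"

end

theory Submission
  imports Defs
begin

text \<open>
  Testing the intersection body equation against \<open>g \<theta> = \<bar>T\<^sup>-\<^sup>1 \<theta>\<bar>\<close> to the power \<open>-(n - 1)\<close>, for an
  invertible linear map \<open>T\<close> with transpose \<open>T'\<close>, turns it into an identity between the Gaussian mean of
  \<open>1 / \<parallel>T z\<parallel>\<close>, where \<open>\<parallel>\<cdot>\<parallel>\<close> is the norm of \<open>K\<close>, and a multiple of \<open>\<integral> 1 / \<bar>T' \<xi>\<bar> d\<mu>\<close>. Choose coordinates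
  \<open>z = (x, y)\<close> adapted to the decomposition and stretch \<open>x\<close> by a factor \<open>s\<close>. Then
  \<open>\<bar>T' \<xi>\<bar>\<^sup>2 = s\<^sup>2 a \<xi> + b \<xi>\<close>, so the right-hand side \<open>J s\<close> is a convex function of \<open>s\<^sup>2\<close>. On the left,
  \<open>\<parallel>T z\<parallel> = max (s \<parallel>x\<parallel>) \<parallel>y\<parallel>\<close>, so \<open>J 0 - J s\<close> only sees the region \<open>\<parallel>y\<parallel> < s \<parallel>x\<parallel>\<close>; when \<open>y\<close> has at
  least four coordinates this makes it \<open>o(s\<^sup>2)\<close>. A convex function of \<open>s\<^sup>2\<close> with vanishing derivative at
  \<open>0\<close> is nondecreasing, which contradicts \<open>J 1 < J 0\<close>.
\<close>

section \<open>Lebesgue measure over an orthonormal family\<close>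

text \<open>Where the values of \<open>radial K\<close> at the images of \<open>y\<close> and of
  \<open>s x + y\<close> differ, the difference is at most of order \<open>1 / |y|\<close>, and
  \<open>s |x| / |y|\<close> is bounded below there. So the difference is at most a constant times
  \<open>(s |x|) powr p / |y| powr (p + 1)\<close> for every \<open>p > 0\<close>. Beating
  \<open>s ^ 2\<close> needs \<open>p > 2\<close>; integrability of
  \<open>|y| powr (- (p + 1))\<close> near 0 needs \<open>p + 1\<close> to be less than the
  dimension of the \<open>y\<close> space. Dimension four leaves room for both, and
  \<open>p = 5/2\<close> is the source of the exponents 5/2 and 7/2.

  The Gaussian weight replaces spheres and their sections by linear spaces, where linear
  substitutions are exact. No determinant is computed: the Gaussian mass of an ellipsoid appears on
  both sides and cancels.

  The map with \<open>s = 0\<close> is not invertible, so the identity is available for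
  \<open>s > 0\<close> only and no derivative at 0 is taken. Convexity is used at the three points
  \<open>(\<delta> / 2) ^ 2\<close>, \<open>\<delta> ^ 2\<close> and 1 instead, and the value at
  \<open>\<delta> / 2\<close> is merely bounded by the one at 0.\<close>

definition frame_lborel :: "'a::euclidean_space set \<Rightarrow> 'a measure" where
  "frame_lborel B = distr (\<Pi>\<^sub>M b\<in>B. lborel) borel (\<lambda>f. \<Sum>b\<in>B. f b *\<^sub>R b)"

definition gauss_int :: ennreal where
  "gauss_int = (\<integral>\<^sup>+t. ennreal (exp (- (t\<^sup>2))) \<partial>lborel)"

lemma sets_frame_lborel [measurable_cong, simp]: "sets (frame_lborel B) = sets borel"
  by (simp add: frame_lborel_def)

lemma space_frame_lborel [simp]: "space (frame_lborel B) = UNIV"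
  by (simp add: frame_lborel_def)

lemma measurable_frame_sum:
  fixes B :: "'a::euclidean_space set"
  shows
  "(\<lambda>f. \<Sum>b\<in>B. f b *\<^sub>R b) \<in> borel_measurable (\<Pi>\<^sub>M b\<in>B. (lborel :: real measure))"
  by (intro borel_measurable_sum borel_measurable_scaleR) (auto intro: measurable_component_singleton)

lemma nn_integral_frame_lborel:
  assumes "h \<in> borel_measurable borel"
  shows "(\<integral>\<^sup>+x. h x \<partial>frame_lborel B) = (\<integral>\<^sup>+f. h (\<Sum>b\<in>B. f b *\<^sub>R b) \<partial>(\<Pi>\<^sub>M b\<in>B. lborel))"
  unfolding frame_lborel_def using assms by (intro nn_integral_distr measurable_frame_sum) simp

text \<open>The measure lives on the whole space, which avoids restricted sigma-algebras, but it is
  carried by \<open>span B\<close>. This is how an identity valid only inside a hyperplane enters an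
  integral.\<close>

lemma nn_integral_frame_lborel_cong:
  assumes "h \<in> borel_measurable borel" "h' \<in> borel_measurable borel" "\<And>x. x \<in> span B \<Longrightarrow> h x = h' x"
  shows "(\<integral>\<^sup>+x. h x \<partial>frame_lborel B) = (\<integral>\<^sup>+x. h' x \<partial>frame_lborel B)"
  unfolding nn_integral_frame_lborel[OF assms(1)] nn_integral_frame_lborel[OF assms(2)]
  by (intro nn_integral_cong assms(3) span_sum span_scale span_base)

lemma nn_integral_frame_lborel_empty:
  assumes "h \<in> borel_measurable borel"
  shows "(\<integral>\<^sup>+x. h x \<partial>frame_lborel {}) = h 0"
  unfolding nn_integral_frame_lborel[OF assms] by (simp add: PiM_empty nn_integral_count_space_finite)

text \<open>Tonelli, splitting off one direction. This is the step of all inductions over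
  \<open>B\<close>, and also the slicing of space into parallel hyperplanes.\<close>

lemma nn_integral_frame_lborel_insert:
  assumes "finite B" "b \<notin> B" and h[measurable]: "h \<in> borel_measurable borel"
  shows "(\<integral>\<^sup>+x. h x \<partial>frame_lborel (insert b B)) = (\<integral>\<^sup>+t. \<integral>\<^sup>+x. h (x + t *\<^sub>R b) \<partial>frame_lborel B \<partial>lborel)"
proof -
  interpret product_sigma_finite "\<lambda>_. lborel :: real measure" by standard
  have "(\<integral>\<^sup>+x. h x \<partial>frame_lborel (insert b B)) =
      (\<integral>\<^sup>+t. \<integral>\<^sup>+f. h (\<Sum>c\<in>insert b B. (f(b := t)) c *\<^sub>R c) \<partial>(\<Pi>\<^sub>M b\<in>B. lborel) \<partial>lborel)"
    unfolding nn_integral_frame_lborel[OF h]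
    by (rule product_nn_integral_insert_rev[OF assms(1,2)])
       (rule measurable_compose[OF measurable_frame_sum h])
  also have "\<dots> = (\<integral>\<^sup>+t. \<integral>\<^sup>+f. h ((\<Sum>c\<in>B. f c *\<^sub>R c) + t *\<^sub>R b) \<partial>(\<Pi>\<^sub>M b\<in>B. lborel) \<partial>lborel)"
  proof (intro nn_integral_cong)
    fix t :: real and f :: "'a \<Rightarrow> real"
    have "(\<Sum>c\<in>B. (f(b := t)) c *\<^sub>R c) = (\<Sum>c\<in>B. f c *\<^sub>R c)"
      using assms(2) by (intro sum.cong) auto
    then show "h (\<Sum>c\<in>insert b B. (f(b := t)) c *\<^sub>R c) = h ((\<Sum>c\<in>B. f c *\<^sub>R c) + t *\<^sub>R b)"
      using assms by (simp add: add.commute)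
  qed
  also have "\<dots> = (\<integral>\<^sup>+t. \<integral>\<^sup>+x. h (x + t *\<^sub>R b) \<partial>frame_lborel B \<partial>lborel)"
    by (intro nn_integral_cong nn_integral_frame_lborel[symmetric]) measurable
  finally show ?thesis .
qed

section \<open>Gaussian integrals on the line and over orthonormal families\<close>

lemma gauss_int_pos: "gauss_int \<noteq> 0"
proof
  assume "gauss_int = 0"
  then have "AE t in lborel. ennreal (exp (- (t\<^sup>2))) = 0"
    unfolding gauss_int_def by (subst (asm) nn_integral_0_iff_AE) auto
  then have "AE t in (lborel :: real measure). False" by eventually_elim simp
  then show False by (auto simp: AE_iff_null null_sets_def)
qed

text \<open>From \<open>(t - 1) ^ 2 \<ge> 0\<close> the Gaussian is at most
  \<open>exp (1/2) * exp (- t)\<close>, so the Gamma integral dominates. Real exponents are allowed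
  because the singular weight \<open>powr (-7/8)\<close> is needed later, with
  \<open>x = 1/8\<close>.\<close>

lemma nn_integral_half_gauss_moment_finite:
  assumes "x > (0::real)"
  shows "(\<integral>\<^sup>+t. ennreal (indicator {0<..} t * (t powr (x - 1) * exp (- (t\<^sup>2) / 2))) \<partial>lborel) < \<infinity>"
proof -
  have "(\<integral>\<^sup>+t. ennreal (indicator {0<..} t * (t powr (x - 1) * exp (- (t\<^sup>2) / 2))) \<partial>lborel)
      \<le> (\<integral>\<^sup>+t. ennreal (exp (1/2)) * ennreal (indicator {0..} t * t powr (x - 1) / exp t) \<partial>lborel)"
  proof (intro nn_integral_mono, subst ennreal_mult[symmetric])
    fix t :: real
    have "0 \<le> (t - 1)\<^sup>2" by simp
    then have "- (t\<^sup>2) / 2 \<le> 1/2 + - t" by (simp add: power2_eq_square algebra_simps)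
    then have "exp (- (t\<^sup>2) / 2) \<le> exp (1/2 + - t)" by (subst exp_le_cancel_iff)
    also have "\<dots> = exp (1/2) * exp (-t)" by (rule exp_add)
    finally have "exp (- (t\<^sup>2) / 2) \<le> exp (1/2) * exp (-t)" .
    then show "ennreal (indicator {0<..} t * (t powr (x - 1) * exp (- (t\<^sup>2) / 2)))
        \<le> ennreal (exp (1/2) * (indicator {0..} t * t powr (x - 1) / exp t))"
      by (intro ennreal_leI) (auto simp: indicator_def exp_minus field_simps intro!: mult_left_mono)
  qed auto
  also have "\<dots> = ennreal (exp (1/2)) * ennreal (Gamma x)"
    by (subst nn_integral_cmult) (auto simp: Gamma_conv_nn_integral_real[OF assms])
  also have "\<dots> < \<infinity>" by (simp add: ennreal_mult_less_top)
  finally show ?thesis .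
qed

lemma nn_integral_gauss_moment_finite:
  assumes "x > (0::real)"
  shows "(\<integral>\<^sup>+t. ennreal (\<bar>t\<bar> powr (x - 1) * exp (- (t\<^sup>2) / 2)) \<partial>lborel) < \<infinity>"
proof -
  let ?f = "\<lambda>t::real. ennreal (indicator {0<..} t * (t powr (x - 1) * exp (- (t\<^sup>2) / 2)))"
  have "(\<integral>\<^sup>+t. ennreal (\<bar>t\<bar> powr (x - 1) * exp (- (t\<^sup>2) / 2)) \<partial>lborel) = (\<integral>\<^sup>+t. ?f t + ?f (0 + (-1) * t) \<partial>lborel)"
    by (intro nn_integral_cong) (auto simp: indicator_def)
  also have "\<dots> = (\<integral>\<^sup>+t. ?f t \<partial>lborel) + (\<integral>\<^sup>+t. ?f (0 + (-1) * t) \<partial>lborel)"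
    by (rule nn_integral_add) measurable
  also have "(\<integral>\<^sup>+t. ?f (0 + (-1) * t) \<partial>lborel) = (\<integral>\<^sup>+t. ?f t \<partial>lborel)"
    by (subst (2) nn_integral_real_affine[of _ "-1" 0]) auto
  finally show ?thesis using nn_integral_half_gauss_moment_finite[OF assms]
    by simp
qed

lemma nn_integral_exp_half_square_finite: "(\<integral>\<^sup>+t. ennreal (exp (- (t\<^sup>2) / 2)) \<partial>(lborel::real measure)) < \<infinity>"
proof -
  have "(\<integral>\<^sup>+t. ennreal (exp (- (t\<^sup>2) / 2)) \<partial>(lborel::real measure)) =
    (\<integral>\<^sup>+t. ennreal (\<bar>t\<bar> powr (1 - 1) * exp (- (t\<^sup>2) / 2)) \<partial>lborel)"
  \<comment> \<open>The integrands differ at \<open>t = 0\<close>, because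
    \<open>0 powr 0 = 0\<close>.\<close>
  proof (rule nn_integral_cong_AE)
    show "AE t in (lborel::real measure). ennreal (exp (- (t\<^sup>2) / 2)) =
        ennreal (\<bar>t\<bar> powr (1 - 1) * exp (- (t\<^sup>2) / 2))"
      using AE_lborel_singleton[of "0::real"] by eventually_elim simp
  qed
  then show ?thesis using nn_integral_gauss_moment_finite[of 1] by simp
qed

lemma gauss_int_finite: "gauss_int < \<infinity>"
proof -
  have "gauss_int \<le> (\<integral>\<^sup>+t. ennreal (exp (- (t\<^sup>2) / 2)) \<partial>(lborel::real measure))"
    unfolding gauss_int_def by (intro nn_integral_mono ennreal_leI) auto
  with nn_integral_exp_half_square_finite show ?thesis by (rule le_less_trans[rotated])
qed

text \<open>The offset \<open>v\<close> orthogonal to \<open>B\<close> is what makes the induction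
  work: once \<open>b\<close> is split off, \<open>t *\<^sub>R b\<close> joins the offset, and
  Pythagoras separates the two contributions.\<close>

lemma frame_lborel_gauss:
  fixes B :: "'a::euclidean_space set"
  assumes "finite B" "pairwise orthogonal B" "\<And>b. b \<in> B \<Longrightarrow> norm b = 1" "\<And>b. b \<in> B \<Longrightarrow> v \<bullet> b = 0"
  shows "(\<integral>\<^sup>+x. ennreal (exp (- (norm (x + v))\<^sup>2)) \<partial>frame_lborel B) =
    ennreal (exp (- (norm v)\<^sup>2)) * gauss_int ^ card B"
  using assms
proof (induction B arbitrary: v rule: finite_induct)
  case empty
  show ?case by (subst nn_integral_frame_lborel_empty) auto
next
  case (insert b B)
  have "(\<integral>\<^sup>+x. ennreal (exp (- (norm (x + v))\<^sup>2)) \<partial>frame_lborel (insert b B)) =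
      (\<integral>\<^sup>+t. \<integral>\<^sup>+x. ennreal (exp (- (norm (x + (t *\<^sub>R b + v)))\<^sup>2)) \<partial>frame_lborel B \<partial>lborel)"
    by (subst nn_integral_frame_lborel_insert[OF insert.hyps(1,2)]) (auto simp: add.assoc)
  also have "\<dots> = (\<integral>\<^sup>+t. ennreal (exp (- (norm (t *\<^sub>R b + v))\<^sup>2)) * gauss_int ^ card B \<partial>lborel)"
  proof (intro nn_integral_cong insert.IH)
    fix t c assume "c \<in> B"
    with insert.hyps insert.prems have "b \<bullet> c = 0"
      by (auto simp: pairwise_def orthogonal_def)
    with insert.prems \<open>c \<in> B\<close> show "(t *\<^sub>R b + v) \<bullet> c = 0"
      by (simp add: inner_add_left)
  qed (use insert in \<open>auto simp: pairwise_insert\<close>)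
  also have "\<dots> = (\<integral>\<^sup>+t. ennreal (exp (- (norm v)\<^sup>2)) * gauss_int ^ card B * ennreal (exp (- (t\<^sup>2))) \<partial>lborel)"
  proof (intro nn_integral_cong)
    fix t :: real
    have "(norm (t *\<^sub>R b + v))\<^sup>2 = t\<^sup>2 + (norm v)\<^sup>2"
      using insert.prems by (subst norm_add_Pythagorean) (auto simp: orthogonal_def inner_commute)
    then show "ennreal (exp (- (norm (t *\<^sub>R b + v))\<^sup>2)) * gauss_int ^ card B =
       ennreal (exp (- (norm v)\<^sup>2)) * gauss_int ^ card B * ennreal (exp (- (t\<^sup>2)))"
      by (simp add: exp_diff exp_minus field_simps ennreal_mult[symmetric] exp_add)
  qed
  also have "\<dots> = ennreal (exp (- (norm v)\<^sup>2)) * gauss_int ^ card B * gauss_int"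
    unfolding gauss_int_def[symmetric] by (subst nn_integral_cmult) (auto simp: gauss_int_def)
  finally show ?case using insert.hyps by (simp add: mult_ac)
qed

text \<open>Balls have finite measure because a multiple of the Gaussian,
  \<open>exp (n ^ 2) * exp (- |x| ^ 2)\<close>, is at least 1 on the ball of radius
  \<open>n\<close>.\<close>

lemma sigma_finite_frame_lborel:
  fixes B :: "'a::euclidean_space set"
  assumes "finite B" "pairwise orthogonal B" "\<And>b. b \<in> B \<Longrightarrow> norm b = 1"
  shows "sigma_finite_measure (frame_lborel B)"
proof
  have fin: "emeasure (frame_lborel B) (cball 0 (real n)) \<noteq> \<infinity>" for n
  proof -
    have "emeasure (frame_lborel B) (cball 0 (real n)) = (\<integral>\<^sup>+x. indicator (cball 0 (real n)) x \<partial>frame_lborel B)"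
      by simp
    also have "\<dots> \<le> (\<integral>\<^sup>+x. ennreal (exp ((real n)\<^sup>2)) * ennreal (exp (- (norm (x + 0))\<^sup>2)) \<partial>frame_lborel B)"
    proof (intro nn_integral_mono)
      fix x :: 'a
      have "1 \<le> ennreal (exp ((real n)\<^sup>2) * exp (- (norm x)\<^sup>2))" if "norm x \<le> real n"
      proof -
        have "(norm x)\<^sup>2 \<le> (real n)\<^sup>2" using that by (intro power_mono) auto
        then show ?thesis by (simp add: exp_add[symmetric])
      qed
      then show "indicator (cball 0 (real n)) x \<le> ennreal (exp ((real n)\<^sup>2)) * ennreal (exp (- (norm (x + 0))\<^sup>2))"
        by (auto simp: indicator_def ennreal_mult[symmetric])
    qed
    also have "\<dots> = ennreal (exp ((real n)\<^sup>2)) * gauss_int ^ card B"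
      by (subst nn_integral_cmult) (use frame_lborel_gauss[OF assms, of 0] in auto)
    also have "\<dots> < \<infinity>"
      using gauss_int_finite by (auto simp: ennreal_mult_less_top power_less_top_ennreal)
    finally show ?thesis by simp
  qed
  show "\<exists>A. countable A \<and> A \<subseteq> sets (frame_lborel B) \<and> \<Union> A = space (frame_lborel B) \<and>
        (\<forall>a\<in>A. emeasure (frame_lborel B) a \<noteq> \<infinity>)"
    by (rule exI[of _ "range (\<lambda>n. cball 0 (real n))"]) (use fin in \<open>auto intro: real_arch_simple\<close>)
qed

text \<open>Translation and dilation are handled in one induction. Later uses take
  \<open>c = 1\<close> for translation invariance or \<open>w = 0\<close> for scaling.\<close>

lemma frame_lborel_affine:
  fixes B :: "'a::euclidean_space set"
  assumes "finite B" "pairwise orthogonal B" "\<And>b. b \<in> B \<Longrightarrow> norm b = 1"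
    and "h \<in> borel_measurable borel" "w \<in> span B" "c > 0"
  shows "(\<integral>\<^sup>+x. h x \<partial>frame_lborel B) = ennreal (c ^ card B) * (\<integral>\<^sup>+x. h (w + c *\<^sub>R x) \<partial>frame_lborel B)"
  using assms
proof (induction B arbitrary: h w rule: finite_induct)
  case empty
  then show ?case by (subst (1 2) nn_integral_frame_lborel_empty) auto
next
  case (insert b B)
  note h[measurable] = insert.prems(3)
  interpret B: sigma_finite_measure "frame_lborel B"
    using insert by (intro sigma_finite_frame_lborel) (auto simp: pairwise_insert)
  \<comment> \<open>The shift splits into \<open>k\<close> along \<open>b\<close>, treated by the
    one-dimensional substitution, and a rest in \<open>span B\<close>, treated by the induction
    hypothesis.\<close>
  from insert.prems(4) obtain k where k: "w - k *\<^sub>R b \<in> span B"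
    by (auto simp: span_insert)
  define w' where "w' = w - k *\<^sub>R b"
  have IH: "(\<integral>\<^sup>+x. h (x + t *\<^sub>R b) \<partial>frame_lborel B) =
      ennreal (c ^ card B) * (\<integral>\<^sup>+x. h (w' + c *\<^sub>R x + t *\<^sub>R b) \<partial>frame_lborel B)" for t
    using insert k unfolding w'_def by (intro insert.IH) (auto simp: pairwise_insert)
  have "(\<integral>\<^sup>+x. h x \<partial>frame_lborel (insert b B)) =
      (\<integral>\<^sup>+t. ennreal (c ^ card B) * (\<integral>\<^sup>+x. h (w' + c *\<^sub>R x + t *\<^sub>R b) \<partial>frame_lborel B) \<partial>lborel)"
    by (subst nn_integral_frame_lborel_insert[OF insert.hyps(1,2) h]) (simp add: IH)
  also have "\<dots> = ennreal c * (\<integral>\<^sup>+t. ennreal (c ^ card B) * (\<integral>\<^sup>+x. h (w' + c *\<^sub>R x + (k + c * t) *\<^sub>R b) \<partial>frame_lborel B) \<partial>lborel)"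
    using \<open>c > 0\<close> by (subst nn_integral_real_affine[where c = c and t = k]) auto
  also have "\<dots> = ennreal (c ^ card (insert b B)) * (\<integral>\<^sup>+t. \<integral>\<^sup>+x. h (w + c *\<^sub>R (x + t *\<^sub>R b)) \<partial>frame_lborel B \<partial>lborel)"
    using \<open>c > 0\<close> insert.hyps
    by (subst nn_integral_cmult) (auto simp: w'_def algebra_simps ennreal_mult)
  also have "(\<integral>\<^sup>+t. \<integral>\<^sup>+x. h (w + c *\<^sub>R (x + t *\<^sub>R b)) \<partial>frame_lborel B \<partial>lborel) =
      (\<integral>\<^sup>+x. h (w + c *\<^sub>R x) \<partial>frame_lborel (insert b B))"
    by (subst nn_integral_frame_lborel_insert[OF insert.hyps(1,2)]) auto
  finally show ?case .
qed

text \<open>Doubling fixes the set \<open>{0}\<close> but multiplies its mass by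
  \<open>2 ^ card B > 1\<close>. The mass is finite by comparison with the Gaussian, hence
  zero.\<close>

lemma frame_lborel_singleton_null:
  fixes B :: "'a::euclidean_space set"
  assumes "finite B" "pairwise orthogonal B" "\<And>b. b \<in> B \<Longrightarrow> norm b = 1" "B \<noteq> {}"
  shows "AE x in frame_lborel B. x \<noteq> 0"
proof -
  let ?m = "emeasure (frame_lborel B) {0}"
  have "?m = (\<integral>\<^sup>+x. indicator {0} x \<partial>frame_lborel B)" by simp
  also have "\<dots> = ennreal (2 ^ card B) * (\<integral>\<^sup>+x. indicator {0} (0 + 2 *\<^sub>R x) \<partial>frame_lborel B)"
    using assms by (intro frame_lborel_affine) (auto simp: span_zero)
  also have "(\<integral>\<^sup>+x. indicator {0} (0 + 2 *\<^sub>R x) \<partial>frame_lborel B) = (\<integral>\<^sup>+x. indicator {0} x \<partial>frame_lborel B)"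
    by (intro nn_integral_cong) (auto simp: indicator_def)
  finally have eq: "?m = ennreal (2 ^ card B) * ?m" by simp
  have "?m = (\<integral>\<^sup>+x. indicator {0} x \<partial>frame_lborel B)" by simp
  also have "\<dots> \<le> (\<integral>\<^sup>+x. ennreal (exp (- (norm (x + 0))\<^sup>2)) \<partial>frame_lborel B)"
    by (intro nn_integral_mono) (auto simp: indicator_def)
  also have "\<dots> < \<infinity>"
    by (subst frame_lborel_gauss[OF assms(1,2,3)])
       (use gauss_int_finite in \<open>auto simp: ennreal_mult_less_top power_less_top_ennreal\<close>)
  finally obtain r where r: "?m = ennreal r" "r \<ge> 0" by (metis less_top ennreal_cases infinity_ennreal_def less_irrefl)
  from eq r have "r = 2 ^ card B * r" by (simp add: ennreal_mult[symmetric])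
  moreover have "card B > 0" using assms by (simp add: card_gt_0_iff)
  then have "(2::real) ^ card B > 1" by simp
  ultimately have "r = 0" by (metis less_irrefl mult_cancel_right1)
  then show ?thesis using r by (intro AE_I[of _ _ "{0}"]) auto
qed

section \<open>Uniqueness of translation-invariant measures and linear substitutions\<close>

lemma lborel_eq_frame_lborel: "lborel = frame_lborel (Basis :: 'a::euclidean_space set)"
  unfolding frame_lborel_def by (rule lborel_eq)

lemma lborel_gauss: "(\<integral>\<^sup>+x. ennreal (exp (- (norm x)\<^sup>2)) \<partial>(lborel :: 'a::euclidean_space measure)) = gauss_int ^ DIM('a)"
proof -
  have "pairwise orthogonal (Basis :: 'a set)"
    by (auto simp: pairwise_def orthogonal_def inner_not_same_Basis)
  from frame_lborel_gauss[OF finite_Basis this norm_Basis, of 0] show ?thesis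
    by (simp add: lborel_eq_frame_lborel)
qed

text \<open>By Tonelli's theorem, \<open>\<integral>\<integral> f (\<phi> z) g x = \<integral>\<integral> f (x + \<phi> z) g x = \<integral>\<integral> f x g (x - \<phi> z)\<close>.\<close>

lemma translation_invariant_unique:
  fixes \<phi> :: "'b \<Rightarrow> 'a::euclidean_space"
  assumes "sigma_finite_measure M" and [measurable]: "\<phi> \<in> borel_measurable M"
    and inv: "\<And>h w. h \<in> borel_measurable borel \<Longrightarrow> (\<integral>\<^sup>+z. h (\<phi> z + w) \<partial>M) = (\<integral>\<^sup>+z. h (\<phi> z) \<partial>M)"
    and [measurable]: "f \<in> borel_measurable borel" "g \<in> borel_measurable borel"
  shows "(\<integral>\<^sup>+z. f (\<phi> z) \<partial>M) * (\<integral>\<^sup>+x. g x \<partial>lborel) = (\<integral>\<^sup>+x. f x \<partial>lborel) * (\<integral>\<^sup>+z. g (- \<phi> z) \<partial>M)"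
proof -
  interpret M: sigma_finite_measure M by fact
  interpret P: pair_sigma_finite "lborel :: 'a measure" M ..
  interpret P': pair_sigma_finite M "lborel :: 'a measure" ..
  have shift: "(\<integral>\<^sup>+x. h (w + x) \<partial>lborel) = (\<integral>\<^sup>+x. h x \<partial>lborel)"
    if [measurable]: "h \<in> borel_measurable borel" for h :: "'a \<Rightarrow> ennreal" and w
    by (subst (2) lborel_distr_plus[symmetric, of w]) (simp add: nn_integral_distr)
  have "(\<integral>\<^sup>+z. f (\<phi> z) \<partial>M) * (\<integral>\<^sup>+x. g x \<partial>lborel) = (\<integral>\<^sup>+x. (\<integral>\<^sup>+z. f (\<phi> z) \<partial>M) * g x \<partial>lborel)"
    by (subst nn_integral_cmult) auto
  also have "\<dots> = (\<integral>\<^sup>+x. \<integral>\<^sup>+z. f (\<phi> z + x) * g x \<partial>M \<partial>lborel)"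
    by (intro nn_integral_cong, subst nn_integral_multc) (auto simp: inv)
  also have "\<dots> = (\<integral>\<^sup>+z. \<integral>\<^sup>+x. f (\<phi> z + x) * g x \<partial>lborel \<partial>M)"
    by (rule P'.Fubini') measurable
  also have "\<dots> = (\<integral>\<^sup>+z. \<integral>\<^sup>+x. f (\<phi> z + x) * g (- \<phi> z + (\<phi> z + x)) \<partial>lborel \<partial>M)"
    by simp
  also have "\<dots> = (\<integral>\<^sup>+z. \<integral>\<^sup>+x. f x * g (- \<phi> z + x) \<partial>lborel \<partial>M)"
    by (intro nn_integral_cong shift) measurable
  also have "\<dots> = (\<integral>\<^sup>+x. \<integral>\<^sup>+z. f x * g (- \<phi> z + x) \<partial>M \<partial>lborel)"
    by (rule P.Fubini') measurable
  also have "\<dots> = (\<integral>\<^sup>+x. f x * (\<integral>\<^sup>+z. g (- \<phi> z) \<partial>M) \<partial>lborel)"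
  proof (intro nn_integral_cong)
    fix x :: 'a
    have "(\<integral>\<^sup>+z. g (- (\<phi> z + - x)) \<partial>M) = (\<integral>\<^sup>+z. g (- \<phi> z) \<partial>M)"
      by (rule inv) measurable
    then show "(\<integral>\<^sup>+z. f x * g (- \<phi> z + x) \<partial>M) = f x * (\<integral>\<^sup>+z. g (- \<phi> z) \<partial>M)"
      by (subst nn_integral_cmult) auto
  qed
  also have "\<dots> = (\<integral>\<^sup>+x. f x \<partial>lborel) * (\<integral>\<^sup>+z. g (- \<phi> z) \<partial>M)"
    by (rule nn_integral_multc) measurable
  finally show ?thesis .
qed

text \<open>Rotation invariance of Lebesgue measure. Both sides are translation invariant, hence
  proportional, and the factor is 1 because both give the Gaussian the same mass, which is neither 0
  nor infinite.\<close>

lemma frame_lborel_eq_lborel: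
  fixes B :: "'a::euclidean_space set"
  assumes "finite B" "pairwise orthogonal B" "\<And>b. b \<in> B \<Longrightarrow> norm b = 1" "span B = UNIV"
  shows "frame_lborel B = lborel"
proof -
  have "independent B" using assms(2,3) by (intro pairwise_orthogonal_independent) force+
  then have card: "card B = DIM('a)"
    using assms(4) by (metis dim_UNIV dim_span_eq_card_independent)
  have G: "gauss_int ^ DIM('a) \<noteq> 0" "gauss_int ^ DIM('a) \<noteq> top"
    using gauss_int_pos gauss_int_finite by (auto simp: power_eq_top_ennreal)
  have "emeasure (frame_lborel B) A = emeasure lborel A" if A: "A \<in> sets (frame_lborel B)" for A
  proof -
    have [measurable]: "A \<in> sets borel" using A by simp
    let ?g = "\<lambda>x::'a. ennreal (exp (- (norm x)\<^sup>2))"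
    have "(\<integral>\<^sup>+z. indicator A z \<partial>frame_lborel B) * (\<integral>\<^sup>+x. ?g x \<partial>lborel) =
      (\<integral>\<^sup>+x. indicator A x \<partial>lborel) * (\<integral>\<^sup>+z. ?g (- z) \<partial>frame_lborel B)"
    proof (rule translation_invariant_unique)
      show "sigma_finite_measure (frame_lborel B)" using assms by (intro sigma_finite_frame_lborel)
      fix h :: "'a \<Rightarrow> ennreal" and w assume "h \<in> borel_measurable borel"
      then show "(\<integral>\<^sup>+z. h (z + w) \<partial>frame_lborel B) = (\<integral>\<^sup>+z. h z \<partial>frame_lborel B)"
        using frame_lborel_affine[OF assms(1-3), of h w 1] assms by (simp add: add.commute)
    qed auto
    moreover have "(\<integral>\<^sup>+z. ?g (- z) \<partial>frame_lborel B) = gauss_int ^ DIM('a)"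
      using frame_lborel_gauss[OF assms(1-3), of 0] by (simp add: card)
    ultimately show ?thesis using G A
      by (simp add: lborel_gauss mult.commute[of _ "gauss_int ^ DIM('a)"] ennreal_mult_cancel_left)
  qed
  then show ?thesis by (intro measure_eqI) auto
qed

lemma emeasure_lborel_open_nonzero:
  fixes U :: "'a::euclidean_space set"
  assumes "open U" "U \<noteq> {}"
  shows "emeasure lborel U \<noteq> 0"
proof
  assume "emeasure lborel U = 0"
  with assms(1) have "U \<in> null_sets lborel" by (auto simp: null_sets_def)
  then have "negligible U" by (simp add: negligible_iff_null_sets null_sets_completionI)
  with assms open_not_negligible show False by blast
qed

text \<open>The integral of \<open>exp (- (norm (N x))\<^sup>2)\<close> stands for the absolute
  determinant of \<open>T\<close> times \<open>gauss_int ^ DIM('a)\<close>. The uniqueness lemma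
  applies with \<open>T\<close> as the map into the space, since moving \<open>T z\<close> by
  \<open>w\<close> amounts to moving \<open>z\<close> by \<open>N w\<close>.\<close>

lemma linear_change_of_variables:
  fixes T N :: "'a::euclidean_space \<Rightarrow> 'a"
  assumes "linear T" "linear N" "\<And>x. T (N x) = x" "\<And>x. N (T x) = x"
    and [measurable]: "f \<in> borel_measurable borel"
  shows "(\<integral>\<^sup>+z. f (T z) \<partial>lborel) * (\<integral>\<^sup>+x. ennreal (exp (- (norm (N x))\<^sup>2)) \<partial>lborel) =
    (\<integral>\<^sup>+x. f x \<partial>lborel) * gauss_int ^ DIM('a)"
proof -
  have [measurable]: "T \<in> borel_measurable borel" "N \<in> borel_measurable borel"
    using assms by (auto intro!: borel_measurable_continuous_onI linear_continuous_on simp: linear_linear)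
  have "(\<integral>\<^sup>+z. f (T z) \<partial>lborel) * (\<integral>\<^sup>+x. ennreal (exp (- (norm (N x))\<^sup>2)) \<partial>lborel) =
    (\<integral>\<^sup>+x. f x \<partial>lborel) * (\<integral>\<^sup>+z. ennreal (exp (- (norm (N (- T z)))\<^sup>2)) \<partial>lborel)"
  proof (rule translation_invariant_unique)
    show "sigma_finite_measure (lborel :: 'a measure)" ..
    fix h :: "'a \<Rightarrow> ennreal" and w assume [measurable]: "h \<in> borel_measurable borel"
    have "(\<integral>\<^sup>+z. h (T z) \<partial>lborel) = (\<integral>\<^sup>+z. h (T (N w + z)) \<partial>lborel)"
      by (subst (1) lborel_distr_plus[symmetric, of "N w"]) (simp add: nn_integral_distr)
    then show "(\<integral>\<^sup>+z. h (T z + w) \<partial>lborel) = (\<integral>\<^sup>+z. h (T z) \<partial>lborel)"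
      by (simp add: linear_add[OF assms(1)] assms(3) add.commute)
  qed auto
  then show ?thesis
    by (simp add: linear_neg[OF assms(2)] assms(4) lborel_gauss)
qed

text \<open>Needed to cancel this constant. Testing the change of variables on a box of volume 1
  gives a product equal to \<open>gauss_int ^ DIM('a)\<close>, whose other factor is the measure of
  the nonempty open preimage of the box.\<close>

lemma ellipsoid_gauss_pos_finite:
  fixes T N :: "'a::euclidean_space \<Rightarrow> 'a"
  assumes "linear T" "linear N" "\<And>x. T (N x) = x" "\<And>x. N (T x) = x"
  shows "0 < (\<integral>\<^sup>+x. ennreal (exp (- (norm (N x))\<^sup>2)) \<partial>lborel)"
    "(\<integral>\<^sup>+x. ennreal (exp (- (norm (N x))\<^sup>2)) \<partial>lborel) < \<infinity>"
proof -
  let ?Q = "\<integral>\<^sup>+x. ennreal (exp (- (norm (N x))\<^sup>2)) \<partial>lborel"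
  have T: "continuous_on UNIV T"
    using assms by (auto intro!: linear_continuous_on simp: linear_linear)
  then have [measurable]: "T \<in> borel_measurable borel" by (rule borel_measurable_continuous_onI)
  define U where "U = (T -` box 0 (One::'a))"
  have "open U" unfolding U_def using T open_vimage by blast
  moreover have "N ((1/2) *\<^sub>R One) \<in> U" by (simp add: U_def assms mem_box)
  ultimately have U: "emeasure lborel U \<noteq> 0"
    by (intro emeasure_lborel_open_nonzero) auto
  have "(\<integral>\<^sup>+z. indicator (box 0 One) (T z) \<partial>lborel) * ?Q =
    (\<integral>\<^sup>+x. indicator (box 0 (One::'a)) x \<partial>lborel) * gauss_int ^ DIM('a)"
    using assms by (intro linear_change_of_variables) auto
  also have "(\<integral>\<^sup>+z. indicator (box 0 One) (T z) \<partial>lborel) = (\<integral>\<^sup>+z. indicator U z \<partial>lborel)"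
    by (intro nn_integral_cong) (auto simp: U_def indicator_def)
  also have "\<dots> = emeasure lborel U" using \<open>open U\<close> by simp
  finally have eq: "emeasure lborel U * ?Q = gauss_int ^ DIM('a)"
    by (simp add: emeasure_lborel_box)
  show "0 < ?Q" using eq gauss_int_pos by (metis mult_zero_right power_eq_0_iff gr_zeroI)
  show "?Q < \<infinity>"
  proof (rule ccontr)
    assume "\<not> ?Q < \<infinity>"
    then have "?Q = top" by (simp add: not_less top_unique)
    with eq U have "gauss_int ^ DIM('a) = top" by (simp add: ennreal_mult_top)
    with gauss_int_finite show False by (simp add: power_eq_top_ennreal)
  qed
qed

section \<open>Surface measure and polar coordinates\<close>

lemma subspace_onb:
  assumes "subspace V"
  shows "pairwise orthogonal (subspace_onb V)" "\<And>b. b \<in> subspace_onb V \<Longrightarrow> norm b = 1"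
    "span (subspace_onb V) = V" "finite (subspace_onb V)" "card (subspace_onb V) = dim V"
proof -
  have "\<exists>B. pairwise orthogonal B \<and> (\<forall>b\<in>B. norm b = 1) \<and> span B = V"
    using orthonormal_basis_subspace[OF assms] by metis
  then have "pairwise orthogonal (subspace_onb V) \<and> (\<forall>b\<in>subspace_onb V. norm b = 1) \<and> span (subspace_onb V) = V"
    unfolding subspace_onb_def by (rule someI_ex)
  then show *: "pairwise orthogonal (subspace_onb V)" "\<And>b. b \<in> subspace_onb V \<Longrightarrow> norm b = 1"
    "span (subspace_onb V) = V" by auto
  have ind: "independent (subspace_onb V)"
    using * by (intro pairwise_orthogonal_independent) force+
  then show "finite (subspace_onb V)" by (rule independent_imp_finite)
  show "card (subspace_onb V) = dim V"
    using ind *(3) dim_span_eq_card_independent by metis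
qed

lemma borel_measurable_sgn_vector [measurable]:
  "(sgn :: 'a::euclidean_space \<Rightarrow> 'a) \<in> borel_measurable borel"
  unfolding sgn_div_norm[abs_def] by measurable

text \<open>The nested \<open>scale_measure\<close>, \<open>distr\<close> and
  \<open>restrict_space\<close> of the cone formula are unfolded here once and for all. What remains
  is a plain integral over the punctured unit ball of a function of the direction
  \<open>sgn x\<close>.\<close>

lemma
  fixes V :: "'a::euclidean_space set"
  assumes "subspace V"
  shows space_sphere_measure: "space (sphere_measure V) = sphere 0 1 \<inter> V"
    and sets_sphere_measure: "sets (sphere_measure V) = sets (restrict_space borel (sphere 0 1 \<inter> V))"
    and nn_integral_sphere_measure: "f \<in> borel_measurable borel \<Longrightarrow>
      (\<integral>\<^sup>+\<theta>. f \<theta> \<partial>sphere_measure V) =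
        of_nat (dim V) * (\<integral>\<^sup>+x. f (sgn x) * indicator (cball 0 1 - {0}) x \<partial>frame_lborel (subspace_onb V))"
proof -
  show "space (sphere_measure V) = sphere 0 1 \<inter> V"
    by (simp add: sphere_measure_def space_scale_measure space_restrict_space)
  show "sets (sphere_measure V) = sets (restrict_space borel (sphere 0 1 \<inter> V))"
    by (simp add: sphere_measure_def)
  assume f[measurable]: "f \<in> borel_measurable borel"
  let ?B = "subspace_onb V" and ?S = "restrict_space borel (sphere 0 1 \<inter> V)"
    and ?M = "subspace_lborel V" and ?C = "cball 0 1 - {0::'a}"
  note B = subspace_onb[OF assms]
  have "(\<lambda>x. f (sgn x) * indicator C x) \<in> borel_measurable borel" if [measurable]: "C \<in> sets borel" for C
    by measurable
  from this[of ?C] have [measurable]: "(\<lambda>x. f (sgn x) * indicator ?C x) \<in> borel_measurable borel"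
    by auto
  have sum: "(\<lambda>f. \<Sum>b\<in>?B. f b *\<^sub>R b) \<in> measurable (\<Pi>\<^sub>M b\<in>?B. lborel) (restrict_space borel V)"
    using assms B
    by (intro measurable_restrict_space2 measurable_frame_sum Pi_I)
       (metis (no_types, lifting) span_base span_scale span_sum)
  have M: "space ?M = V" "sets ?M = sets (restrict_space borel V)"
    by (simp_all add: subspace_lborel_def space_restrict_space)
  have sgn: "sgn \<in> measurable (restrict_space ?M ?C) ?S"
  proof (rule measurable_restrict_space2)
    show "sgn \<in> space (restrict_space ?M ?C) \<rightarrow> sphere 0 1 \<inter> V"
      using assms by (auto simp: space_restrict_space M norm_sgn sgn_div_norm subspace_scale)
    have "sgn \<in> measurable ?M borel"
      using M by (subst measurable_cong_sets[OF M(2) refl]) (auto intro: measurable_restrict_space1)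
    then show "sgn \<in> measurable (restrict_space ?M ?C) borel"
      by (rule measurable_restrict_space1)
  qed
  have fS: "f \<in> borel_measurable ?S" by (rule measurable_restrict_space1) fact
  have C: "?C \<inter> space ?M \<in> sets ?M"
    unfolding M by (simp add: sets_restrict_space Int_commute image_iff) (rule bexI[of _ ?C], auto)
  have "(\<integral>\<^sup>+\<theta>. f \<theta> \<partial>sphere_measure V) = of_nat (dim V) * (\<integral>\<^sup>+\<theta>. f \<theta> \<partial>distr (restrict_space ?M ?C) ?S sgn)"
    unfolding sphere_measure_def by (rule nn_integral_scale_measure) (simp add: fS)
  also have "(\<integral>\<^sup>+\<theta>. f \<theta> \<partial>distr (restrict_space ?M ?C) ?S sgn) = (\<integral>\<^sup>+x. f (sgn x) * indicator ?C x \<partial>?M)"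
    by (subst nn_integral_distr[OF sgn]) (simp_all add: fS nn_integral_restrict_space[OF C])
  also have "\<dots> = (\<integral>\<^sup>+y. f (sgn (\<Sum>b\<in>?B. y b *\<^sub>R b)) * indicator ?C (\<Sum>b\<in>?B. y b *\<^sub>R b) \<partial>(\<Pi>\<^sub>M b\<in>?B. lborel))"
    unfolding subspace_lborel_def
    by (rule nn_integral_distr[OF sum]) (simp, rule measurable_restrict_space1, measurable)
  also have "\<dots> = (\<integral>\<^sup>+x. f (sgn x) * indicator ?C x \<partial>frame_lborel ?B)"
    by (rule nn_integral_frame_lborel[symmetric]) measurable
  finally show "(\<integral>\<^sup>+\<theta>. f \<theta> \<partial>sphere_measure V) =
        of_nat (dim V) * (\<integral>\<^sup>+x. f (sgn x) * indicator ?C x \<partial>frame_lborel ?B)" .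
qed

lemma nn_integral_inverse_power:
  assumes "a > 0" "d > 0"
  shows "(\<integral>\<^sup>+r. ennreal (inverse (r ^ (d + 1))) * indicator {a..} r \<partial>lborel) = ennreal (1 / (real d * a ^ d))"
proof -
  have "(\<integral>\<^sup>+r. ennreal (inverse (r ^ (d + 1))) * indicator {a..} r \<partial>lborel) = ennreal (0 - (- inverse (real d * a ^ d)))"
  proof (rule nn_integral_FTC_atLeast)
    fix r assume "a \<le> r"
    with assms have r: "r > 0" by simp
    have "((\<lambda>r. - inverse (real d * r ^ d)) has_real_derivative
        (real d * (real d * r ^ (d - 1)) * inverse ((real d * r ^ d)\<^sup>2))) (at r)"
      using r assms by (auto intro!: derivative_eq_intros simp: power2_eq_square)
    also have "real d * (real d * r ^ (d - 1)) * inverse ((real d * r ^ d)\<^sup>2) = inverse (r ^ (d + 1))"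
    proof -
      have "D * (D * r ^ k) * inverse ((D * (r * r ^ k))\<^sup>2) = inverse (r * (r * r ^ k))" if "D > 0" for D :: real and k
        using that r by (simp add: power2_eq_square field_simps)
      from this[of "real d" "d - 1"] show ?thesis using assms by (cases d) auto
    qed
    finally show "DERIV (\<lambda>r. - inverse (real d * r ^ d)) r :> inverse (r ^ (d + 1))" .
    show "0 \<le> inverse (r ^ (d + 1))" using r by simp
  next
    have "filterlim (\<lambda>r. real d * r ^ d) at_top at_top"
      using assms by (intro filterlim_tendsto_pos_mult_at_top[OF tendsto_const] filterlim_pow_at_top filterlim_ident) auto
    from tendsto_minus[OF tendsto_inverse_0_at_top[OF this]]
    show "((\<lambda>r. - inverse (real d * r ^ d)) \<longlongrightarrow> 0) at_top" by simp
  qed auto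
  then show ?thesis by (simp add: divide_inverse)
qed

text \<open>With \<open>d = card B\<close>, the substitution \<open>y = r x\<close> turns the right-hand side into the integral of
  \<open>h y\<close> against the factor \<open>d \<bar>y\<bar>\<^sup>d \<integral> 1 / r\<^bsup>d + 1\<^esup> dr\<close> over \<open>r \<ge> \<bar>y\<bar>\<close>, which is \<open>1\<close>.\<close>

lemma nn_integral_polar:
  fixes B :: "'a::euclidean_space set"
  assumes B: "finite B" "pairwise orthogonal B" "\<And>b. b \<in> B \<Longrightarrow> norm b = 1" "B \<noteq> {}"
    and h[measurable]: "h \<in> borel_measurable borel"
  shows "(\<integral>\<^sup>+x. h x \<partial>frame_lborel B) = of_nat (card B) * (\<integral>\<^sup>+x. ennreal (indicator (cball 0 1 - {0}) x * norm x ^ card B) *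
    (\<integral>\<^sup>+r. ennreal (indicator {0<..} r * r ^ (card B - 1)) * h (r *\<^sub>R x) \<partial>lborel) \<partial>frame_lborel B)"
proof -
  interpret M: sigma_finite_measure "frame_lborel B" using B by (intro sigma_finite_frame_lborel)
  interpret P: pair_sigma_finite "lborel :: real measure" "frame_lborel B" ..
  interpret P': pair_sigma_finite "frame_lborel B" "lborel :: real measure" ..
  define d where "d = card B"
  define C where "C = cball 0 1 - {0::'a}"
  have [measurable]: "C \<in> sets borel" by (auto simp: C_def)
  have d: "d > 0" using B by (simp add: d_def card_gt_0_iff)
  \<comment> \<open>Integrand after \<open>y = r x\<close>: the condition
    \<open>0 < |x| \<le> 1\<close> becomes \<open>0 < |y| \<le> r\<close>, and
    \<open>|x| ^ d * r ^ (d - 1)\<close> times the Jacobian \<open>r ^ (- d)\<close> becomes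
    \<open>|y| ^ d / r ^ (d + 1)\<close>.\<close>
  define F where "F = (\<lambda>r y. ennreal (indicator {0<..} r * indicator {0<..r} (norm y) * norm y ^ d * inverse (r ^ (d + 1))) * h y)"
  have [measurable]: "case_prod F \<in> borel_measurable (lborel \<Otimes>\<^sub>M frame_lborel B)"
  proof -
    have "F = (\<lambda>r y. ennreal ((if 0 < r \<and> 0 < norm y \<and> norm y \<le> r then 1 else 0) * norm y ^ d * inverse (r ^ (d + 1))) * h y)"
      by (auto simp: F_def indicator_def fun_eq_iff)
    then show ?thesis by simp
  qed
  have "(\<integral>\<^sup>+x. ennreal (indicator (cball 0 1 - {0}) x * norm x ^ d) *
      (\<integral>\<^sup>+r. ennreal (indicator {0<..} r * r ^ (d - 1)) * h (r *\<^sub>R x) \<partial>lborel) \<partial>frame_lborel B) =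
      (\<integral>\<^sup>+x. \<integral>\<^sup>+r. ennreal (indicator (cball 0 1 - {0}) x * norm x ^ d) *
        (ennreal (indicator {0<..} r * r ^ (d - 1)) * h (r *\<^sub>R x)) \<partial>lborel \<partial>frame_lborel B)"
    by (intro nn_integral_cong nn_integral_cmult[symmetric]) measurable
  also have "\<dots> = (\<integral>\<^sup>+r. \<integral>\<^sup>+x. ennreal (indicator (cball 0 1 - {0}) x * norm x ^ d) *
        (ennreal (indicator {0<..} r * r ^ (d - 1)) * h (r *\<^sub>R x)) \<partial>frame_lborel B \<partial>lborel)"
    unfolding C_def[symmetric] by (rule P.Fubini') measurable
  also have "\<dots> = (\<integral>\<^sup>+r. \<integral>\<^sup>+y. F r y \<partial>frame_lborel B \<partial>lborel)"
  proof (rule nn_integral_cong)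
    fix r :: real
    show "(\<integral>\<^sup>+x. ennreal (indicator (cball 0 1 - {0}) x * norm x ^ d) *
        (ennreal (indicator {0<..} r * r ^ (d - 1)) * h (r *\<^sub>R x)) \<partial>frame_lborel B) = (\<integral>\<^sup>+y. F r y \<partial>frame_lborel B)"
    proof (cases "r > 0")
      case True
      have [measurable]: "F r \<in> borel_measurable borel" unfolding F_def by measurable
      have "(\<integral>\<^sup>+y. F r y \<partial>frame_lborel B) = ennreal (r ^ d) * (\<integral>\<^sup>+y. F r (0 + r *\<^sub>R y) \<partial>frame_lborel B)"
        using B True unfolding d_def by (intro frame_lborel_affine) (auto simp: span_zero)
      also have "\<dots> = (\<integral>\<^sup>+y. ennreal (r ^ d) * F r (0 + r *\<^sub>R y) \<partial>frame_lborel B)"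
        by (rule nn_integral_cmult[symmetric]) measurable
      also have "\<dots> = (\<integral>\<^sup>+x. ennreal (indicator (cball 0 1 - {0}) x * norm x ^ d) *
        (ennreal (indicator {0<..} r * r ^ (d - 1)) * h (r *\<^sub>R x)) \<partial>frame_lborel B)"
      proof (rule nn_integral_cong)
        fix x :: 'a
        show "ennreal (r ^ d) * F r (0 + r *\<^sub>R x) = ennreal (indicator (cball 0 1 - {0}) x * norm x ^ d) *
          (ennreal (indicator {0<..} r * r ^ (d - 1)) * h (r *\<^sub>R x))"
        proof (cases "0 < norm x \<and> norm x \<le> 1")
          case xx: True
          have "r ^ d * ((r * norm x) ^ d * inverse (r ^ (d + 1))) = norm x ^ d * r ^ (d - 1)"
            using True d by (cases d) (auto simp: field_simps)
          with True xx show ?thesis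
            by (simp add: F_def indicator_def mult.assoc[symmetric] ennreal_mult[symmetric])
        next
          case False
          with True show ?thesis by (auto simp: F_def indicator_def)
        qed
      qed
      finally show ?thesis by simp
    qed (simp add: F_def)
  qed
  also have "\<dots> = (\<integral>\<^sup>+y. \<integral>\<^sup>+r. F r y \<partial>lborel \<partial>frame_lborel B)"
    by (rule P'.Fubini') measurable
  finally have eq: "(\<integral>\<^sup>+x. ennreal (indicator (cball 0 1 - {0}) x * norm x ^ d) *
      (\<integral>\<^sup>+r. ennreal (indicator {0<..} r * r ^ (d - 1)) * h (r *\<^sub>R x) \<partial>lborel) \<partial>frame_lborel B) =
      (\<integral>\<^sup>+y. \<integral>\<^sup>+r. F r y \<partial>lborel \<partial>frame_lborel B)" .
  have "of_nat d * (\<integral>\<^sup>+y. \<integral>\<^sup>+r. F r y \<partial>lborel \<partial>frame_lborel B) =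
      (\<integral>\<^sup>+y. of_nat d * (\<integral>\<^sup>+r. F r y \<partial>lborel) \<partial>frame_lborel B)"
    by (rule nn_integral_cmult[symmetric]) measurable
  also have "\<dots> = (\<integral>\<^sup>+y. h y \<partial>frame_lborel B)"
  proof (rule nn_integral_cong_AE)
    show "AE y in frame_lborel B. of_nat d * (\<integral>\<^sup>+r. F r y \<partial>lborel) = h y"
    proof -
      have "AE y in frame_lborel B. y \<noteq> 0" by (rule frame_lborel_singleton_null) (use B in auto)
      then show ?thesis
      proof eventually_elim
        fix y :: 'a assume y: "y \<noteq> 0"
        have "(\<integral>\<^sup>+r. F r y \<partial>lborel) = (\<integral>\<^sup>+r. (ennreal (norm y ^ d) * h y) * (ennreal (inverse (r ^ (d + 1))) * indicator {norm y..} r) \<partial>lborel)"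
          using y by (intro nn_integral_cong)
            (auto simp: F_def indicator_def ennreal_mult' mult_ac zero_less_norm_iff
               dest: less_le_trans[OF iffD2[OF zero_less_norm_iff]])
        also have "\<dots> = (ennreal (norm y ^ d) * h y) * ennreal (1 / (real d * norm y ^ d))"
          using y d by (subst nn_integral_cmult) (auto simp: nn_integral_inverse_power[simplified])
        finally have "of_nat d * (\<integral>\<^sup>+r. F r y \<partial>lborel) =
            h y * (ennreal (real d) * ennreal (norm y ^ d) * ennreal (1 / (real d * norm y ^ d)))"
          by (simp add: mult_ac ennreal_of_nat_eq_real_of_nat)
        also have "ennreal (real d) * ennreal (norm y ^ d) * ennreal (1 / (real d * norm y ^ d)) = 1"
          using y d by (simp add: ennreal_mult[symmetric])
        finally show "of_nat d * (\<integral>\<^sup>+r. F r y \<partial>lborel) = h y" by simp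
      qed
    qed
  qed
  finally show ?thesis using eq by (simp add: d_def)
qed

section \<open>Gaussian integrals and surface measure\<close>

text \<open>This is half the Gamma function at \<open>(k + 1) / 2\<close>.\<close>

definition gauss_moment :: "nat \<Rightarrow> ennreal" where
  "gauss_moment k = (\<integral>\<^sup>+r. ennreal (indicator {0<..} r * (r ^ k * exp (- (r\<^sup>2)))) \<partial>lborel)"

lemma gauss_moment_pos: "gauss_moment k \<noteq> 0"
proof
  assume "gauss_moment k = 0"
  then have "AE r in lborel. ennreal (indicator {0<..} r * (r ^ k * exp (- (r\<^sup>2)))) = 0"
    unfolding gauss_moment_def by (subst (asm) nn_integral_0_iff_AE) auto
  then have "AE r in lborel. r \<notin> {0<..<1::real}"
    by eventually_elim (auto simp: indicator_def ennreal_eq_0_iff mult_le_0_iff not_le dest: zero_less_power[where n = k] split: if_splits)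
  then have "{0<..<1::real} \<in> null_sets lborel" by (subst AE_iff_null_sets) auto
  then show False by (simp add: null_sets_def)
qed

lemma gauss_moment_finite: "gauss_moment k < \<infinity>"
proof -
  have "gauss_moment k \<le> (\<integral>\<^sup>+t. ennreal (indicator {0<..} t * (t powr (real (k + 1) - 1) * exp (- (t\<^sup>2) / 2))) \<partial>lborel)"
    unfolding gauss_moment_def
    by (intro nn_integral_mono ennreal_leI) (auto simp: indicator_def powr_realpow intro!: mult_left_mono)
  also have "\<dots> < \<infinity>" by (rule nn_integral_half_gauss_moment_finite) simp
  finally show ?thesis .
qed

lemma gauss_moment_scale:
  assumes "c > 0"
  shows "(\<integral>\<^sup>+r. ennreal (indicator {0<..} r * (r ^ k * exp (- ((c * r)\<^sup>2)))) \<partial>lborel) =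
    ennreal (1 / c ^ (k + 1)) * gauss_moment k"
proof -
  have "gauss_moment k = ennreal \<bar>c\<bar> * (\<integral>\<^sup>+r. ennreal (indicator {0<..} (0 + c * r) * ((0 + c * r) ^ k * exp (- ((0 + c * r)\<^sup>2)))) \<partial>lborel)"
    unfolding gauss_moment_def using assms by (intro nn_integral_real_affine) auto
  also have "(\<integral>\<^sup>+r. ennreal (indicator {0<..} (0 + c * r) * ((0 + c * r) ^ k * exp (- ((0 + c * r)\<^sup>2)))) \<partial>lborel) =
     (\<integral>\<^sup>+r. ennreal (c ^ k) * ennreal (indicator {0<..} r * (r ^ k * exp (- ((c * r)\<^sup>2)))) \<partial>lborel)"
    using assms by (intro nn_integral_cong)
      (auto simp: indicator_def ennreal_mult[symmetric] power_mult_distrib zero_less_mult_iff mult_ac)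
  also have "\<dots> = ennreal (c ^ k) * (\<integral>\<^sup>+r. ennreal (indicator {0<..} r * (r ^ k * exp (- ((c * r)\<^sup>2)))) \<partial>lborel)"
    by (rule nn_integral_cmult) measurable
  finally have "ennreal (1 / c ^ (k + 1)) * gauss_moment k = (ennreal (1 / c ^ (k + 1)) * ennreal \<bar>c\<bar> * ennreal (c ^ k)) *
     (\<integral>\<^sup>+r. ennreal (indicator {0<..} r * (r ^ k * exp (- ((c * r)\<^sup>2)))) \<partial>lborel)"
    by (simp add: mult.assoc)
  also have "ennreal (1 / c ^ (k + 1)) * ennreal \<bar>c\<bar> * ennreal (c ^ k) = 1"
    using assms by (simp add: ennreal_mult[symmetric])
  finally show ?thesis by simp
qed

text \<open>Since \<open>p\<close> is homogeneous of degree \<open>- j\<close>, the integral along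
  each ray is a Gaussian moment times \<open>p x / norm (N x) ^ (dim V - j)\<close>. Multiplied by
  the weight \<open>norm x ^ dim V\<close> of the polar formula, this depends on
  \<open>sgn x\<close> only, as the cone formula requires. The two uses are \<open>j = 1\<close> on
  the whole space with a radial function and \<open>j = 0\<close> on a hyperplane with
  \<open>p = 1\<close>. Both yield the power \<open>n - 1\<close> of
  \<open>norm (N \<theta>)\<close> and the moment \<open>n - 2\<close>, which explains the exponent
  of the test function.\<close>

lemma nn_integral_sphere_gauss:
  fixes N :: "'a::euclidean_space \<Rightarrow> 'a" and p :: "'a \<Rightarrow> real"
  assumes V: "subspace V" and j: "j < dim V"
    and N: "linear N" "\<And>x. N x = 0 \<Longrightarrow> x = 0"
    and p[measurable]: "p \<in> borel_measurable borel" and p0: "\<And>x. x \<noteq> 0 \<Longrightarrow> 0 \<le> p x"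
    and hom: "\<And>r x. r > 0 \<Longrightarrow> x \<noteq> 0 \<Longrightarrow> p (r *\<^sub>R x) = p x / r ^ j"
  shows "(\<integral>\<^sup>+x. ennreal (p x * exp (- (norm (N x))\<^sup>2)) \<partial>frame_lborel (subspace_onb V)) =
    gauss_moment (dim V - 1 - j) * (\<integral>\<^sup>+\<theta>. ennreal (p \<theta> / norm (N \<theta>) ^ (dim V - j)) \<partial>sphere_measure V)"
proof -
  let ?B = "subspace_onb V"
  note B = subspace_onb[OF V]
  have [measurable]: "N \<in> borel_measurable borel"
    using N by (auto intro!: borel_measurable_continuous_onI linear_continuous_on simp: linear_linear)
  define d where "d = dim V"
  define C where "C = cball 0 1 - {0::'a}"
  have [measurable]: "C \<in> sets borel" by (auto simp: C_def)
  have Bne: "?B \<noteq> {}" using j B(5) by (metis card.empty not_less_zero)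
  have "(\<integral>\<^sup>+x. ennreal (p x * exp (- (norm (N x))\<^sup>2)) \<partial>frame_lborel ?B) = of_nat d *
    (\<integral>\<^sup>+x. ennreal (indicator (cball 0 1 - {0}) x * norm x ^ d) *
    (\<integral>\<^sup>+r. ennreal (indicator {0<..} r * r ^ (d - 1)) * ennreal (p (r *\<^sub>R x) * exp (- (norm (N (r *\<^sub>R x)))\<^sup>2)) \<partial>lborel) \<partial>frame_lborel ?B)"
    using nn_integral_polar[OF B(4,1,2) Bne, of "\<lambda>x. ennreal (p x * exp (- (norm (N x))\<^sup>2))"]
    by (simp add: d_def B(5))
  also have "(\<integral>\<^sup>+x. ennreal (indicator (cball 0 1 - {0}) x * norm x ^ d) *
    (\<integral>\<^sup>+r. ennreal (indicator {0<..} r * r ^ (d - 1)) * ennreal (p (r *\<^sub>R x) * exp (- (norm (N (r *\<^sub>R x)))\<^sup>2)) \<partial>lborel) \<partial>frame_lborel ?B) =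
    (\<integral>\<^sup>+x. gauss_moment (d - 1 - j) * (ennreal (p (sgn x) / norm (N (sgn x)) ^ (d - j)) * indicator (cball 0 1 - {0}) x) \<partial>frame_lborel ?B)"
  proof (rule nn_integral_cong)
    fix x :: 'a
    show "ennreal (indicator (cball 0 1 - {0}) x * norm x ^ d) *
      (\<integral>\<^sup>+r. ennreal (indicator {0<..} r * r ^ (d - 1)) * ennreal (p (r *\<^sub>R x) * exp (- (norm (N (r *\<^sub>R x)))\<^sup>2)) \<partial>lborel) =
      gauss_moment (d - 1 - j) * (ennreal (p (sgn x) / norm (N (sgn x)) ^ (d - j)) * indicator (cball 0 1 - {0}) x)"
    proof (cases "x \<in> cball 0 1 - {0}")
      case True
      then have x: "x \<noteq> 0" by auto
      then have Nx: "norm (N x) > 0" using N(2) by auto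
      define q where "q = p x * (1 / norm (N x) ^ (d - j))"
      have q: "q \<ge> 0" using p0[OF x] by (simp add: q_def)
      have "(\<integral>\<^sup>+r. ennreal (indicator {0<..} r * r ^ (d - 1)) * ennreal (p (r *\<^sub>R x) * exp (- (norm (N (r *\<^sub>R x)))\<^sup>2)) \<partial>lborel) =
        (\<integral>\<^sup>+r. ennreal (p x) * ennreal (indicator {0<..} r * (r ^ (d - 1 - j) * exp (- ((norm (N x) * r)\<^sup>2)))) \<partial>lborel)"
      proof (rule nn_integral_cong)
        fix r :: real
        show "ennreal (indicator {0<..} r * r ^ (d - 1)) * ennreal (p (r *\<^sub>R x) * exp (- (norm (N (r *\<^sub>R x)))\<^sup>2)) =
          ennreal (p x) * ennreal (indicator {0<..} r * (r ^ (d - 1 - j) * exp (- ((norm (N x) * r)\<^sup>2))))"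
        proof (cases "r > 0")
          case True
          have "d - 1 = (d - 1 - j) + j" using j by (simp add: d_def)
          then have "r ^ (d - 1) = r ^ (d - 1 - j) * r ^ j" by (metis power_add)
          with True x show ?thesis
            by (simp add: hom[OF True x] linear_scale[OF N(1)] p0[OF x] ennreal_mult[symmetric] mult_ac)
        qed simp
      qed
      also have "\<dots> = ennreal (p x) * (ennreal (1 / norm (N x) ^ (d - 1 - j + 1)) * gauss_moment (d - 1 - j))"
        by (subst nn_integral_cmult) (auto simp: gauss_moment_scale[OF Nx])
      also have "d - 1 - j + 1 = d - j" using j by (simp add: d_def)
      finally have 1: "(\<integral>\<^sup>+r. ennreal (indicator {0<..} r * r ^ (d - 1)) * ennreal (p (r *\<^sub>R x) * exp (- (norm (N (r *\<^sub>R x)))\<^sup>2)) \<partial>lborel) =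
        gauss_moment (d - 1 - j) * ennreal q"
        using p0[OF x] unfolding q_def by (subst ennreal_mult) (auto simp: mult_ac)
      have inv: "inverse (norm x) > 0" using x by simp
      have nd: "norm x ^ d = norm x ^ (d - j) * norm x ^ j" using j by (simp add: d_def power_add[symmetric])
      have ps: "p (sgn x) = p x * norm x ^ j"
        by (simp add: sgn_div_norm hom[OF inv x] power_inverse divide_inverse)
      have ns: "norm (N (sgn x)) = norm (N x) / norm x"
        by (simp add: sgn_div_norm linear_scale[OF N(1)] divide_inverse mult.commute)
      have "p (sgn x) / norm (N (sgn x)) ^ (d - j) = norm x ^ d * q"
        unfolding q_def ps ns nd power_divide using x Nx by simp
      with 1 True q show ?thesis by (simp add: ennreal_mult mult_ac)
    qed simp
  qed
  also have "\<dots> = gauss_moment (d - 1 - j) * (\<integral>\<^sup>+x. ennreal (p (sgn x) / norm (N (sgn x)) ^ (d - j)) * indicator (cball 0 1 - {0}) x \<partial>frame_lborel ?B)"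
    unfolding C_def[symmetric] by (rule nn_integral_cmult) measurable
  also have "of_nat d * \<dots> = gauss_moment (d - 1 - j) * (\<integral>\<^sup>+\<theta>. ennreal (p \<theta> / norm (N \<theta>) ^ (d - j)) \<partial>sphere_measure V)"
    by (subst nn_integral_sphere_measure[OF V]) (auto simp: d_def mult_ac)
  finally show ?thesis by (simp add: d_def)
qed

text \<open>Completing the square: with \<open>v = T (T' \<xi>) / \<bar>T' \<xi>\<bar>\<^sup>2\<close> one has \<open>\<xi> \<bullet> v = 1\<close>, and \<open>N v\<close> is
  orthogonal to the image under \<open>N\<close> of the hyperplane.\<close>

lemma hyperplane_gauss:
  fixes T N T' :: "'a::euclidean_space \<Rightarrow> 'a"
  assumes T: "linear T" "linear N" "\<And>x. T (N x) = x" "\<And>x. N (T x) = x"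
    and adj: "\<And>x y. T x \<bullet> y = x \<bullet> T' y" and \<xi>: "norm \<xi> = 1" and \<eta>: "T' \<xi> \<noteq> 0"
  shows "(\<integral>\<^sup>+x. ennreal (exp (- (norm (N x))\<^sup>2)) \<partial>lborel) =
    (\<integral>\<^sup>+x. ennreal (exp (- (norm (N x))\<^sup>2)) \<partial>frame_lborel (subspace_onb {x. \<xi> \<bullet> x = 0})) * (ennreal (norm (T' \<xi>)) * gauss_int)"
proof -
  define V where "V = {x. \<xi> \<bullet> x = 0}"
  have V: "subspace V" unfolding V_def by (rule subspace_hyperplane)
  note B = subspace_onb[OF V]
  let ?B = "subspace_onb V" and ?c = "norm (T' \<xi>)"
  have BV: "b \<in> ?B \<Longrightarrow> \<xi> \<bullet> b = 0" for b using B(3) span_base[of b ?B] by (auto simp: V_def)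
  have notin: "\<xi> \<notin> ?B" using BV[of \<xi>] \<xi> by (auto simp: norm_eq_1)
  have [measurable]: "N \<in> borel_measurable borel"
    using T by (auto intro!: borel_measurable_continuous_onI linear_continuous_on simp: linear_linear)
  have c: "?c > 0" using \<eta> by simp
  \<comment> \<open>Completing a basis of the hyperplane by its unit normal \<open>\<xi>\<close>
    slices space into the translates by \<open>t *\<^sub>R \<xi>\<close>.\<close>
  have "frame_lborel (insert \<xi> ?B) = lborel"
  proof (rule frame_lborel_eq_lborel)
    show "pairwise orthogonal (insert \<xi> ?B)"
      using B(1) BV by (auto simp: pairwise_insert orthogonal_def inner_commute)
    have "x \<in> span (insert \<xi> ?B)" for x
    proof -
      have "x - (\<xi> \<bullet> x) *\<^sub>R \<xi> \<in> span ?B" unfolding B(3) using \<xi> by (simp add: V_def inner_diff_right norm_eq_1)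
      then show ?thesis by (auto simp: span_insert)
    qed
    then show "span (insert \<xi> ?B) = UNIV" by auto
  qed (use B \<xi> in auto)
  then have "(\<integral>\<^sup>+x. ennreal (exp (- (norm (N x))\<^sup>2)) \<partial>lborel) =
      (\<integral>\<^sup>+x. ennreal (exp (- (norm (N x))\<^sup>2)) \<partial>frame_lborel (insert \<xi> ?B))" by simp
  also have "\<dots> = (\<integral>\<^sup>+t. \<integral>\<^sup>+x. ennreal (exp (- (norm (N (x + t *\<^sub>R \<xi>)))\<^sup>2)) \<partial>frame_lborel ?B \<partial>lborel)"
    by (rule nn_integral_frame_lborel_insert[OF B(4) notin]) measurable
  also have "\<dots> = (\<integral>\<^sup>+t. (\<integral>\<^sup>+x. ennreal (exp (- (norm (N x))\<^sup>2)) \<partial>frame_lborel ?B) * ennreal (exp (- ((t / ?c)\<^sup>2))) \<partial>lborel)"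
  proof (rule nn_integral_cong)
    fix t :: real
    define v where "v = (1 / ?c\<^sup>2) *\<^sub>R T (T' \<xi>)"
    have "\<xi> \<bullet> v = 1"
      using c by (simp add: v_def inner_commute[of \<xi>] adj power2_norm_eq_inner)
    \<comment> \<open>Moving each slice within its own hyperplane replaces the offset
      \<open>t *\<^sub>R \<xi>\<close> by \<open>t *\<^sub>R v\<close>, for which the Gaussian
      factors.\<close>
    then have "t *\<^sub>R (v - \<xi>) \<in> span ?B" unfolding B(3) using \<xi> by (simp add: V_def inner_diff_right norm_eq_1)
    then have "(\<integral>\<^sup>+x. ennreal (exp (- (norm (N (x + t *\<^sub>R \<xi>)))\<^sup>2)) \<partial>frame_lborel ?B) =
        (\<integral>\<^sup>+x. ennreal (exp (- (norm (N ((t *\<^sub>R (v - \<xi>) + x) + t *\<^sub>R \<xi>)))\<^sup>2)) \<partial>frame_lborel ?B)"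
      by (subst frame_lborel_affine[OF B(4,1,2), where w = "t *\<^sub>R (v - \<xi>)" and c = 1]) auto
    also have "\<dots> = (\<integral>\<^sup>+x. ennreal (exp (- (norm (N x))\<^sup>2)) * ennreal (exp (- ((t / ?c)\<^sup>2))) \<partial>frame_lborel ?B)"
    proof (rule nn_integral_frame_lborel_cong)
      fix x assume "x \<in> span ?B"
      then have x: "\<xi> \<bullet> x = 0" unfolding B(3) by (simp add: V_def)
      have "N (t *\<^sub>R (v - \<xi>) + x + t *\<^sub>R \<xi>) = N (x + t *\<^sub>R v)" by (simp add: algebra_simps)
      also have "\<dots> = N x + (t / ?c\<^sup>2) *\<^sub>R T' \<xi>"
        using T by (simp add: linear_add linear_scale v_def)
      also have "(norm \<dots>)\<^sup>2 = (norm (N x))\<^sup>2 + (norm ((t / ?c\<^sup>2) *\<^sub>R T' \<xi>))\<^sup>2"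
        using x by (intro norm_add_Pythagorean)
          (simp add: orthogonal_def adj[symmetric] T inner_commute)
      also have "(norm ((t / ?c\<^sup>2) *\<^sub>R T' \<xi>))\<^sup>2 = (t / ?c)\<^sup>2"
        using c by (simp add: power_mult_distrib power_divide field_simps power2_eq_square)
      finally show "ennreal (exp (- (norm (N (t *\<^sub>R (v - \<xi>) + x + t *\<^sub>R \<xi>)))\<^sup>2)) =
          ennreal (exp (- (norm (N x))\<^sup>2)) * ennreal (exp (- ((t / ?c)\<^sup>2)))"
        by (simp add: ennreal_mult[symmetric] exp_add[symmetric])
    qed measurable
    also have "\<dots> = (\<integral>\<^sup>+x. ennreal (exp (- (norm (N x))\<^sup>2)) \<partial>frame_lborel ?B) * ennreal (exp (- ((t / ?c)\<^sup>2)))"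
      by (rule nn_integral_multc) measurable
    finally show "(\<integral>\<^sup>+x. ennreal (exp (- (norm (N (x + t *\<^sub>R \<xi>)))\<^sup>2)) \<partial>frame_lborel ?B) =
      (\<integral>\<^sup>+x. ennreal (exp (- (norm (N x))\<^sup>2)) \<partial>frame_lborel ?B) * ennreal (exp (- ((t / ?c)\<^sup>2)))" .
  qed
  also have "\<dots> = (\<integral>\<^sup>+x. ennreal (exp (- (norm (N x))\<^sup>2)) \<partial>frame_lborel ?B) * (\<integral>\<^sup>+t. ennreal (exp (- ((t / ?c)\<^sup>2))) \<partial>lborel)"
    by (rule nn_integral_cmult) measurable
  also have "(\<integral>\<^sup>+t. ennreal (exp (- ((t / ?c)\<^sup>2))) \<partial>lborel) = ennreal ?c * gauss_int"
    unfolding gauss_int_def using c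
    by (subst nn_integral_real_affine[where c = ?c and t = 0]) auto
  finally show ?thesis by (simp add: V_def)
qed


text \<open>With \<open>Q\<close> the ellipsoid mass, \<open>\<gamma>\<close> the moment and
  \<open>G\<close> the one-dimensional Gaussian integral, the Radon transform of \<open>g\<close> at
  \<open>\<xi>\<close> is \<open>Q / (\<gamma> * G * |T' \<xi>|)\<close>. The sphere integral
  \<open>S\<close> of \<open>\<rho> * g\<close> satisfies
  \<open>J * Q = \<gamma> * S * G ^ n\<close>. Equating both sides cancels \<open>Q\<close> and
  \<open>\<gamma>\<close> and leaves \<open>G ^ (n - 1)\<close>. The bound \<open>n \<ge> 2\<close>
  makes the hyperplanes at least one-dimensional, as the polar formula requires.\<close>

lemma radon_identity:
  fixes T N T' :: "'a::euclidean_space \<Rightarrow> 'a" and \<rho> :: "'a \<Rightarrow> real" and \<mu> :: "'a measure"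
  assumes n: "DIM('a) \<ge> 2"
    and T: "linear T" "linear N" "\<And>x. T (N x) = x" "\<And>x. N (T x) = x"
    and adj: "\<And>x y. T x \<bullet> y = x \<bullet> T' y"
    and \<rho>[measurable]: "\<rho> \<in> borel_measurable borel" and \<rho>0: "\<And>x. x \<noteq> 0 \<Longrightarrow> 0 \<le> \<rho> x"
    and hom: "\<And>r x. r > 0 \<Longrightarrow> x \<noteq> 0 \<Longrightarrow> \<rho> (r *\<^sub>R x) = \<rho> x / r"
    and cont: "continuous_on (sphere 0 1) \<rho>"
    and \<mu>: "sets \<mu> = sets (restrict_space borel (sphere (0::'a) 1))"
    and eq: "\<And>g. continuous_on (sphere 0 1) g \<Longrightarrow>
      (LINT \<xi>|sphere_measure UNIV. \<rho> \<xi> * g \<xi>) = (LINT \<xi>|\<mu>. spherical_radon g \<xi>)"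
  shows "(\<integral>\<^sup>+z. ennreal (\<rho> (T z) * exp (- (norm z)\<^sup>2)) \<partial>lborel) =
    ennreal (enn2real gauss_int ^ (DIM('a) - 1) * (LINT \<xi>|\<mu>. 1 / norm (T' \<xi>)))"
proof -
  define n where "n = DIM('a)"
  have [measurable]: "N \<in> borel_measurable borel"
    using T by (auto intro!: borel_measurable_continuous_onI linear_continuous_on simp: linear_linear)
  have N0: "N x = 0 \<Longrightarrow> x = 0" for x using T by (metis linear_0)
  have T'0: "T' \<xi> \<noteq> 0" if "norm \<xi> = 1" for \<xi>
  proof
    assume "T' \<xi> = 0"
    then have "T (N \<xi>) \<bullet> \<xi> = 0" by (simp add: adj)
    with that T show False by (simp add: norm_eq_1)
  qed
  define g where "g = (\<lambda>\<theta>. 1 / norm (N \<theta>) ^ (n - 1))"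
  have g[measurable]: "g \<in> borel_measurable borel" unfolding g_def by measurable
  have g0: "0 \<le> g \<theta>" for \<theta> by (simp add: g_def)
  have cont_g: "continuous_on (sphere 0 1) g"
    unfolding g_def using N0 T
    by (intro continuous_intros linear_continuous_on) (force simp: linear_linear)+
  define S where "S = (\<integral>\<^sup>+\<theta>. ennreal (\<rho> \<theta> * g \<theta>) \<partial>sphere_measure (UNIV :: 'a set))"
  define Q where "Q = (\<integral>\<^sup>+x. ennreal (exp (- (norm (N x))\<^sup>2)) \<partial>lborel)"
  define q where "q = enn2real Q"
  define \<gamma> where "\<gamma> = enn2real (gauss_moment (n - 2))"
  define G where "G = enn2real gauss_int"
  have q: "Q = ennreal q" "q > 0"
    using ellipsoid_gauss_pos_finite[OF T] by (auto simp: Q_def q_def enn2real_positive_iff)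
  have \<gamma>: "gauss_moment (n - 2) = ennreal \<gamma>" "\<gamma> > 0"
    using gauss_moment_finite[of "n - 2"] gauss_moment_pos[of "n - 2"]
    by (auto simp: \<gamma>_def enn2real_positive_iff zero_less_iff_neq_zero)
  have G: "gauss_int = ennreal G" "G > 0"
    using gauss_int_finite gauss_int_pos by (auto simp: G_def enn2real_positive_iff zero_less_iff_neq_zero)
  \<comment> \<open>The Bochner integral is only \<open>enn2real S\<close>, and
    \<open>enn2real\<close> sends infinity to 0; finiteness makes it carry the value of
    \<open>S\<close>.\<close>
  have S_finite: "S < \<infinity>"
  proof -
    have "compact ((\<lambda>\<theta>. \<rho> \<theta> * g \<theta>) ` sphere 0 1)"
      by (intro compact_continuous_image continuous_on_mult cont cont_g) simp
    then obtain C where C: "\<And>\<theta>. \<theta> \<in> sphere 0 1 \<Longrightarrow> norm (\<rho> \<theta> * g \<theta>) \<le> C"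
      by (meson bounded_iff compact_imp_bounded imageI)
    have "S = of_nat n * (\<integral>\<^sup>+x. ennreal (\<rho> (sgn x) * g (sgn x)) * indicator (cball 0 1 - {0}) x \<partial>frame_lborel (subspace_onb UNIV))"
      unfolding S_def n_def by (subst nn_integral_sphere_measure) auto
    also have "\<dots> = of_nat n * (\<integral>\<^sup>+x. ennreal (\<rho> (sgn x) * g (sgn x)) * indicator (cball 0 1 - {0}) x \<partial>lborel)"
      using subspace_onb[of "UNIV :: 'a set"] by (subst frame_lborel_eq_lborel) auto
    also have "\<dots> \<le> of_nat n * (\<integral>\<^sup>+x. ennreal C * indicator (cball 0 1) x \<partial>(lborel :: 'a measure))"
    proof (intro mult_left_mono nn_integral_mono)
      fix x :: 'a
      have "\<rho> (sgn x) * g (sgn x) \<le> C" if "x \<noteq> 0" using C[of "sgn x"] that by (auto simp: norm_sgn)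
      then show "ennreal (\<rho> (sgn x) * g (sgn x)) * indicator (cball 0 1 - {0}) x \<le> ennreal C * indicator (cball 0 1) x"
        by (auto simp: indicator_def intro!: ennreal_leI)
    qed auto
    also have "\<dots> = of_nat n * (ennreal C * emeasure lborel (cball 0 1 :: 'a set))"
      by (subst nn_integral_cmult) (auto intro: borel_measurable_indicator)
    also have "\<dots> < \<infinity>"
      using emeasure_lborel_cball_finite[of "0::'a" 1] by (simp add: ennreal_mult_less_top ennreal_of_nat_eq_real_of_nat)
    finally show ?thesis .
  qed
  define s where "s = enn2real S"
  have s: "S = ennreal s" "s \<ge> 0" using S_finite by (simp_all add: s_def)
  have meas: "f \<in> borel_measurable (sphere_measure V)" if "subspace V" "f \<in> borel_measurable borel" for V and f :: "'a \<Rightarrow> real"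
    using that sets_sphere_measure[OF that(1)]
    by (subst measurable_cong_sets[OF _ refl, of _ "restrict_space borel (sphere 0 1 \<inter> V)"])
      (auto intro: measurable_restrict_space1)
  have "(LINT \<xi>|sphere_measure UNIV. \<rho> \<xi> * g \<xi>) = s"
    unfolding s_def S_def
  proof (rule integral_eq_nn_integral)
    show "(\<lambda>\<xi>. \<rho> \<xi> * g \<xi>) \<in> borel_measurable (sphere_measure UNIV)" by (rule meas) auto
    show "AE x in sphere_measure UNIV. 0 \<le> \<rho> x * g x"
      using g0 by (intro AE_I2 mult_nonneg_nonneg \<rho>0) (auto simp: space_sphere_measure)
  qed
  with eq[OF cont_g] have s_eq: "s = (LINT \<xi>|\<mu>. spherical_radon g \<xi>)" by simp
  also have "\<dots> = (LINT \<xi>|\<mu>. q / (\<gamma> * G) * (1 / norm (T' \<xi>)))"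
  proof (rule Bochner_Integration.integral_cong)
    fix \<xi> assume "\<xi> \<in> space \<mu>"
    then have \<xi>: "norm \<xi> = 1" using sets_eq_imp_space_eq[OF \<mu>] by (auto simp: space_restrict_space)
    define V where "V = {x. \<xi> \<bullet> x = 0}"
    have V: "subspace V" unfolding V_def by (rule subspace_hyperplane)
    have dim: "dim V = n - 1" unfolding V_def n_def using \<xi> by (intro dim_hyperplane) auto
    define R where "R = (\<integral>\<^sup>+\<theta>. ennreal (g \<theta>) \<partial>sphere_measure V)"
    have "(\<integral>\<^sup>+x. ennreal (exp (- (norm (N x))\<^sup>2)) \<partial>frame_lborel (subspace_onb V)) = gauss_moment (n - 2) * R"
      using nn_integral_sphere_gauss[OF V, of 0 N "\<lambda>_. 1"] n N0 T
      by (simp add: dim R_def g_def n_def numeral_2_eq_2)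
    with hyperplane_gauss[OF T adj \<xi> T'0[OF \<xi>]]
    have 1: "ennreal q = ennreal \<gamma> * R * (ennreal (norm (T' \<xi>)) * ennreal G)"
      by (simp add: V_def \<gamma> G Q_def[symmetric] q)
    have pos: "\<gamma> * (norm (T' \<xi>) * G) > 0" using \<gamma> G T'0[OF \<xi>] by simp
    from 1 have 2: "ennreal q = ennreal (\<gamma> * (norm (T' \<xi>) * G)) * R"
      using \<gamma> G by (simp add: ennreal_mult mult_ac)
    have "R \<noteq> top" using 2 \<gamma> G T'0[OF \<xi>] by (auto simp: ennreal_mult_top)
    then obtain r where r: "R = ennreal r" "r \<ge> 0" by (cases R) auto
    from 2 pos q r have "q = \<gamma> * (norm (T' \<xi>) * G) * r"
      by (simp add: ennreal_mult[symmetric] del: ennreal_mult_eq_top_iff)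
    then have "r = q / (\<gamma> * G) * (1 / norm (T' \<xi>))" using pos by (auto simp: field_simps)
    moreover have "spherical_radon g \<xi> = enn2real R"
      unfolding spherical_radon_def R_def V_def[symmetric]
      by (rule integral_eq_nn_integral[OF meas[OF V g]]) (simp add: g0)
    ultimately show "spherical_radon g \<xi> = q / (\<gamma> * G) * (1 / norm (T' \<xi>))" using r by simp
  qed simp
  finally have s': "s = q / (\<gamma> * G) * (LINT \<xi>|\<mu>. 1 / norm (T' \<xi>))" by (simp only: integral_mult_right_zero)
  define J where "J = (\<integral>\<^sup>+z. ennreal (\<rho> (T z) * exp (- (norm z)\<^sup>2)) \<partial>lborel)"
  have "(\<integral>\<^sup>+x. ennreal (\<rho> x * exp (- (norm (N x))\<^sup>2)) \<partial>frame_lborel (subspace_onb UNIV)) = gauss_moment (n - 2) * S"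
    using nn_integral_sphere_gauss[of "UNIV :: 'a set" 1 N \<rho>] n N0 T \<rho>0 hom
    by (simp add: S_def g_def n_def numeral_2_eq_2)
  moreover have "frame_lborel (subspace_onb (UNIV :: 'a set)) = lborel"
    using subspace_onb[of "UNIV :: 'a set"] by (intro frame_lborel_eq_lborel) auto
  moreover have "J * Q = (\<integral>\<^sup>+x. ennreal (\<rho> x * exp (- (norm (N x))\<^sup>2)) \<partial>lborel) * gauss_int ^ n"
    unfolding J_def Q_def n_def
    using linear_change_of_variables[OF T, of "\<lambda>x. ennreal (\<rho> x * exp (- (norm (N x))\<^sup>2))"] by (simp add: T)
  ultimately have "J * ennreal q = ennreal \<gamma> * ennreal s * ennreal G ^ n"
    by (simp only: \<gamma>(1) G(1) s(1) q(1))
  then have "J * ennreal q = ennreal (\<gamma> * s * G ^ n)"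
    using \<gamma>(2) G(2) s(2) by (simp add: ennreal_mult ennreal_power)
  moreover then have "J \<noteq> top" using q by (auto simp: ennreal_top_mult)
  then obtain j where j: "J = ennreal j" "j \<ge> 0" by (cases J) auto
  ultimately have "j * q = \<gamma> * s * G ^ n"
    using q \<gamma> G s by (simp add: ennreal_mult[symmetric])
  moreover have "G ^ n = G * G ^ (n - 1)" using n by (simp add: n_def power_eq_if)
  ultimately have "j = G ^ (n - 1) * (LINT \<xi>|\<mu>. 1 / norm (T' \<xi>))"
    using q \<gamma> G by (simp add: s' field_simps)
  then show ?thesis using j by (simp add: J_def G_def n_def)
qed

section \<open>Coordinates adapted to a direct sum\<close>

definition coord_proj :: "'a::euclidean_space set \<Rightarrow> 'a \<Rightarrow> 'a" where
  "coord_proj S z = (\<Sum>i\<in>S. (z \<bullet> i) *\<^sub>R i)"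

lemma linear_coord_proj: "linear (coord_proj S)"
  unfolding coord_proj_def
  by (intro linearI) (auto simp: inner_add_left scaleR_add_left sum.distrib scaleR_sum_right)

lemma coord_proj_in_span: "coord_proj S z \<in> span S"
  unfolding coord_proj_def by (intro span_sum span_scale span_base)

lemma coord_proj_compl:
  assumes "S \<subseteq> Basis"
  shows "z - coord_proj S z = coord_proj (Basis - S) z"
proof -
  have "z = (\<Sum>i\<in>Basis. (z \<bullet> i) *\<^sub>R i)" by (simp add: euclidean_representation)
  also have "\<dots> = coord_proj (Basis - S) z + coord_proj S z"
    unfolding coord_proj_def by (rule sum.subset_diff[OF assms finite_Basis])
  finally show ?thesis by (simp add: diff_eq_eq)
qed

lemma coord_proj_inner_Basis:
  assumes "S \<subseteq> Basis" "i \<in> Basis"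
  shows "coord_proj S z \<bullet> i = (if i \<in> S then z \<bullet> i else 0)"
proof -
  have fin: "finite S" using assms finite_subset[OF _ finite_Basis] by blast
  have "coord_proj S z \<bullet> i = (\<Sum>k\<in>S. if k = i then z \<bullet> i else 0)"
    unfolding coord_proj_def inner_sum_left using assms
    by (intro sum.cong) (auto simp: inner_Basis subset_iff)
  also have "\<dots> = (if i \<in> S then z \<bullet> i else 0)" using fin by simp
  finally show ?thesis .
qed

lemma coord_proj_idem:
  assumes "S \<subseteq> Basis"
  shows "coord_proj S (coord_proj S z) = coord_proj S z"
  unfolding coord_proj_def[of S "coord_proj S z"] coord_proj_def[of S z, symmetric]
  using assms by (subst (2) coord_proj_def) (intro sum.cong, auto simp: coord_proj_inner_Basis subset_iff)

lemma coord_proj_adjoint: "coord_proj S x \<bullet> y = x \<bullet> coord_proj S y"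
  unfolding coord_proj_def inner_sum_left inner_sum_right by (simp add: inner_commute mult.commute)

text \<open>The spans of \<open>A\<close> and \<open>B\<close> need not be orthogonal. Stretching
  along coordinate subspaces keeps the map self-adjoint and lets Pythagoras split the norm; a
  separate linear map \<open>L\<close> then carries these subspaces to the spans.\<close>

definition coord_stretch :: "'a::euclidean_space set \<Rightarrow> real \<Rightarrow> 'a \<Rightarrow> 'a" where
  "coord_stretch S s z = s *\<^sub>R coord_proj S z + (z - coord_proj S z)"

lemma linear_coord_stretch: "linear (coord_stretch S s)"
  unfolding coord_stretch_def
  by (intro linear_compose_add linear_compose_scale_right linear_compose_sub linear_coord_proj linear_id[unfolded id_def])

lemma coord_stretch_adjoint: "coord_stretch S s x \<bullet> y = x \<bullet> coord_stretch S s y"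
  by (simp add: coord_stretch_def inner_add_left inner_add_right inner_diff_left inner_diff_right coord_proj_adjoint)

lemma coord_stretch_inverse:
  assumes "S \<subseteq> Basis" "s * t = 1"
  shows "coord_stretch S s (coord_stretch S t z) = z"
proof -
  have "coord_proj S (coord_stretch S t z) = t *\<^sub>R coord_proj S z"
    by (simp add: coord_stretch_def linear_add[OF linear_coord_proj] linear_diff[OF linear_coord_proj]
        linear_scale[OF linear_coord_proj] coord_proj_idem[OF assms(1)])
  then show ?thesis using assms(2) by (simp add: coord_stretch_def[of S s] coord_stretch_def[of S t])
qed

lemma norm_coord_stretch:
  assumes "S \<subseteq> Basis"
  shows "(norm (coord_stretch S s z))\<^sup>2 = s\<^sup>2 * (norm (coord_proj S z))\<^sup>2 + (norm (z - coord_proj S z))\<^sup>2"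
proof -
  have "coord_proj S z \<bullet> (z - coord_proj S z) = 0"
    using coord_proj_adjoint[of S "coord_proj S z" z] coord_proj_adjoint[of S "coord_proj S z" "coord_proj S z"]
    by (metis coord_proj_adjoint coord_proj_idem[OF assms] inner_diff_right diff_self)
  then show ?thesis
    unfolding coord_stretch_def
    by (subst norm_add_Pythagorean) (auto simp: orthogonal_def power_mult_distrib)
qed

text \<open>\<open>L\<close> glues isometries of two complementary coordinate subspaces onto
  \<open>U\<close> and \<open>W\<close>. It is not an isometry when \<open>U\<close> and
  \<open>W\<close> are oblique, but it is injective: \<open>L z = 0\<close> puts the image of one
  part into \<open>U \<inter> W\<close>, so both parts vanish.\<close>

lemma direct_sum_coordinates:
  fixes U W :: "'a::euclidean_space set"
  assumes "subspace U" "subspace W" and sum: "{u + v | u v. u \<in> U \<and> v \<in> W} = UNIV" and int: "U \<inter> W = {0}"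
  obtains S :: "'a set" and L :: "'a \<Rightarrow> 'a" where "S \<subseteq> Basis" "card S = dim U" "card (Basis - S) = dim W" "linear L" "inj L"
    "\<And>z. L (coord_proj S z) \<in> U" "\<And>z. L (z - coord_proj S z) \<in> W"
proof -
  have dims: "dim U + dim W = DIM('a)"
    using dim_sums_Int[OF assms(1,2)] by (simp add: sum int)
  then have "dim U \<le> card (Basis :: 'a set)" by simp
  then obtain S :: "'a set" where S: "S \<subseteq> Basis" "card S = dim U"
    by (meson obtain_subset_with_card_n)
  have S': "card (Basis - S) = dim W"
    using S dims by (subst card_Diff_subset) (auto intro: finite_subset[OF _ finite_Basis])
  have dim: "dim (span R) = card R" if "R \<subseteq> Basis" for R :: "'a set"
    using that independent_mono[OF independent_Basis] by (intro dim_span_eq_card_independent)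
  obtain f where f: "linear f" "f ` span S = U" "\<And>x. x \<in> span S \<Longrightarrow> norm (f x) = norm x"
    using isometries_subspaces[OF subspace_span assms(1), of S] S dim[of S] by metis
  have "dim (span (Basis - S)) = dim W" using S' dim[of "Basis - S"] by auto
  then obtain h where h: "linear h" "h ` span (Basis - S) = W" "\<And>x. x \<in> span (Basis - S) \<Longrightarrow> norm (h x) = norm x"
    using isometries_subspaces[OF subspace_span assms(2), of "Basis - S"] by metis
  define L where "L = (\<lambda>z. f (coord_proj S z) + h (z - coord_proj S z))"
  have in2: "z - coord_proj S z \<in> span (Basis - S)" for z
    unfolding coord_proj_compl[OF S(1)] by (rule coord_proj_in_span)
  have P: "coord_proj S (z - coord_proj S z) = 0" for z
    by (simp add: linear_diff[OF linear_coord_proj] coord_proj_idem[OF S(1)])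
  have linL: "linear L"
    unfolding L_def
    using linear_compose[OF linear_coord_proj f(1), of S]
      linear_compose[OF linear_compose_sub[OF linear_id[unfolded id_def] linear_coord_proj] h(1), of S]
    by (intro linear_compose_add) (auto simp: o_def)
  have fU: "f (coord_proj S z) \<in> U" for z using f(2) coord_proj_in_span by blast
  have hW: "h (z - coord_proj S z) \<in> W" for z using h(2) in2 by blast
  show thesis
  proof (rule that[OF S S' linL])
    show "inj L"
    proof (subst linear_injective_0[OF linL], intro allI impI)
      fix z assume "L z = 0"
      then have eq: "f (coord_proj S z) = - h (z - coord_proj S z)" by (simp add: L_def eq_neg_iff_add_eq_0)
      moreover have "- h (z - coord_proj S z) \<in> W" using hW assms(2) by (simp add: subspace_neg)
      ultimately have "f (coord_proj S z) \<in> U \<inter> W" using fU[of z] by (simp only: eq Int_iff)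
      then have 1: "f (coord_proj S z) = 0" using int by blast
      with eq have 2: "h (z - coord_proj S z) = 0" by simp
      have "norm (coord_proj S z) = 0" "norm (z - coord_proj S z) = 0"
        using f(3)[OF coord_proj_in_span, of z] h(3)[OF in2, of z] 1 2 by simp_all
      then show "z = 0" by simp
    qed
    show "L (coord_proj S z) \<in> U" for z
      using fU[of z] h(1) by (simp add: L_def coord_proj_idem[OF S(1)] linear_0)
    show "L (z - coord_proj S z) \<in> W" for z
      using hW[of z] f(1) by (simp add: L_def P linear_0)
  qed
qed

section \<open>A singular Gaussian integral and a convexity inequality\<close>

lemma AE_lborel_inner_nonzero:
  fixes k :: "'a::euclidean_space"
  assumes "k \<noteq> 0"
  shows "AE z in lborel. z \<bullet> k \<noteq> 0"
proof -
  have "negligible {z. k \<bullet> z = 0}" using assms by (intro negligible_hyperplane) simp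
  then have "{z. k \<bullet> z = 0} \<in> null_sets lborel"
    by (simp add: negligible_iff_null_sets null_sets_completion_iff closed_hyperplane)
  then show ?thesis by (rule AE_I') (auto simp: inner_commute)
qed

text \<open>For \<open>y = z - coord_proj S z\<close>, \<open>\<bar>y\<bar>\<close> dominates the geometric mean of four of its coordinates, which
  reduces the claim to the local integrability of \<open>\<bar>t\<bar> powr (-7/8)\<close> on the line.\<close>

lemma singular_gauss_finite:
  assumes S: "S \<subseteq> (Basis :: 'a::euclidean_space set)" and card: "card (Basis - S) \<ge> 4"
  shows "(\<integral>\<^sup>+z. ennreal (norm (coord_proj S z) powr (5/2) * norm (z - coord_proj S z) powr (-7/2) *
    exp (- (norm z)\<^sup>2)) \<partial>(lborel :: 'a measure)) < \<infinity>"
proof -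
  obtain I where I: "I \<subseteq> Basis - S" "card I = 4" using card by (meson obtain_subset_with_card_n)
  have finI: "finite I" using I by (metis card.infinite zero_neq_numeral)
  \<comment> \<open>Only half of the Gaussian exponent is used here; the other half absorbs the
    growth of \<open>t powr (5/2)\<close>.\<close>
  define \<phi> where "\<phi> = (\<lambda>i t. ennreal ((if i \<in> I then \<bar>t\<bar> powr (-7/8) else 1) * exp (- (t\<^sup>2) / 2)))"
  have \<phi>_meas [measurable]: "\<phi> i \<in> borel_measurable borel" for i unfolding \<phi>_def by (cases "i \<in> I") auto
  have bound: "AE z in lborel. ennreal (norm (coord_proj S z) powr (5/2) * norm (z - coord_proj S z) powr (-7/2) * exp (- (norm z)\<^sup>2))
      \<le> 8 * (\<Prod>i\<in>Basis. \<phi> i (z \<bullet> i))"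
  proof -
    \<comment> \<open>The excluded points would break the bound: \<open>0 powr (-7/8) = 0\<close>
      makes the product vanish there.\<close>
    have "AE z in lborel. \<forall>i\<in>I. z \<bullet> i \<noteq> 0"
      using finI I by (intro AE_finite_allI AE_lborel_inner_nonzero) auto
    then show ?thesis
    proof eventually_elim
      fix z :: 'a assume z: "\<forall>i\<in>I. z \<bullet> i \<noteq> 0"
      define t where "t = norm (coord_proj S z)"
      define y where "y = z - coord_proj S z"
      have norm2: "(norm z)\<^sup>2 = t\<^sup>2 + (norm y)\<^sup>2"
        using norm_coord_stretch[OF S, of 1 z] by (simp add: coord_stretch_def t_def y_def)
      have "t powr (5/2) \<le> 8 * exp (t\<^sup>2 / 2)"
      proof (cases "t \<le> 1")
        case True
        then have "t powr (5/2) \<le> 1" by (intro powr_le1) (auto simp: t_def)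
        moreover have "1 \<le> exp (t\<^sup>2 / 2)" by simp
        ultimately show ?thesis by linarith
      next
        case False
        then have "t powr (5/2) \<le> t powr 4" by (intro powr_mono) auto
        also have "t powr 4 = t ^ 4" using False by (simp add: powr_numeral)
        also have "\<dots> \<le> 8 * exp (t\<^sup>2 / 2)"
        proof -
          \<comment> \<open>The quadratic term of the exponential series at \<open>t ^ 2 / 2\<close>
            is \<open>t ^ 4 / 8\<close>, hence the constant 8.\<close>
          have "1 + t\<^sup>2 / 2 + (t\<^sup>2 / 2)\<^sup>2 / 2 \<le> exp (t\<^sup>2 / 2)"
            by (intro exp_lower_Taylor_quadratic) simp
          moreover have "(t\<^sup>2 / 2)\<^sup>2 = t ^ 4 / 4" by (simp add: power_divide)
          moreover have "t\<^sup>2 \<ge> 0" by simp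
          ultimately show ?thesis by linarith
        qed
        finally show ?thesis .
      qed
      also have "\<dots> \<le> 8 * exp ((norm z)\<^sup>2 / 2)" by (simp add: norm2)
      finally have 1: "t powr (5/2) \<le> 8 * exp ((norm z)\<^sup>2 / 2)" .
      have yi: "\<bar>z \<bullet> i\<bar> \<le> norm y" if "i \<in> I" for i
      proof -
        have i: "i \<in> Basis" "i \<notin> S" using that I by auto
        then have "y \<bullet> i = z \<bullet> i" by (simp add: y_def inner_diff_left coord_proj_inner_Basis[OF S])
        then show ?thesis using Basis_le_norm[OF i(1), of y] by simp
      qed
      have "I \<noteq> {}" using I by auto
      then have y0: "norm y > 0" using yi z by force
      have "norm y powr (-7/2) = (norm y powr (-7/8)) ^ 4"
        using y0 by (simp add: powr_realpow[symmetric] powr_powr)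
      also have "\<dots> = (\<Prod>i\<in>I. norm y powr (-7/8))" by (simp add: I)
      also have "\<dots> \<le> (\<Prod>i\<in>I. \<bar>z \<bullet> i\<bar> powr (-7/8))"
        using z yi by (intro prod_mono conjI powr_mono2') auto
      also have "\<dots> = (\<Prod>i\<in>Basis. if i \<in> I then \<bar>z \<bullet> i\<bar> powr (-7/8) else 1)"
        using I by (intro prod.mono_neutral_cong_left) auto
      finally have 2: "norm y powr (-7/2) \<le> (\<Prod>i\<in>Basis. if i \<in> I then \<bar>z \<bullet> i\<bar> powr (-7/8) else 1)" .
      have 3: "exp (- ((norm z)\<^sup>2) / 2) = (\<Prod>i\<in>Basis. exp (- ((z \<bullet> i)\<^sup>2) / 2))"
      proof -
        have "(norm z)\<^sup>2 = (\<Sum>i\<in>Basis. (z \<bullet> i)\<^sup>2)"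
          unfolding power2_norm_eq_inner euclidean_inner[of z z] by (simp add: power2_eq_square)
        then have "- ((norm z)\<^sup>2) / 2 = (\<Sum>i\<in>Basis. - ((z \<bullet> i)\<^sup>2) / 2)"
          by (simp only: sum_divide_distrib[symmetric] sum_negf)
        then show ?thesis by (simp only: exp_sum[OF finite_Basis])
      qed
      have "t powr (5/2) * norm y powr (-7/2) * exp (- (norm z)\<^sup>2) \<le>
        (8 * exp ((norm z)\<^sup>2 / 2)) * (\<Prod>i\<in>Basis. if i \<in> I then \<bar>z \<bullet> i\<bar> powr (-7/8) else 1) * exp (- (norm z)\<^sup>2)"
        by (intro mult_right_mono mult_mono 1 2) auto
      also have "\<dots> = 8 * ((\<Prod>i\<in>Basis. if i \<in> I then \<bar>z \<bullet> i\<bar> powr (-7/8) else 1) * exp (- ((norm z)\<^sup>2) / 2))"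
      proof -
        have "exp ((norm z)\<^sup>2 / 2) * exp (- (norm z)\<^sup>2) = exp (- ((norm z)\<^sup>2) / 2)" by (simp add: exp_add[symmetric])
        then show ?thesis by (simp add: mult_ac)
      qed
      also have "\<dots> = 8 * (\<Prod>i\<in>Basis. (if i \<in> I then \<bar>z \<bullet> i\<bar> powr (-7/8) else 1) * exp (- ((z \<bullet> i)\<^sup>2) / 2))"
        by (simp only: 3 prod.distrib)
      finally show "ennreal (norm (coord_proj S z) powr (5/2) * norm (z - coord_proj S z) powr (-7/2) * exp (- (norm z)\<^sup>2))
        \<le> 8 * (\<Prod>i\<in>Basis. \<phi> i (z \<bullet> i))"
        unfolding \<phi>_def t_def[symmetric] y_def[symmetric]
        by (subst prod_ennreal) (auto simp: ennreal_mult'[symmetric] ennreal_numeral[symmetric] simp del: ennreal_numeral intro!: ennreal_leI)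
    qed
  qed
  have fin: "(\<integral>\<^sup>+t. \<phi> i t \<partial>lborel) < \<infinity>" for i
    using nn_integral_gauss_moment_finite[of "1/8"] nn_integral_exp_half_square_finite
    by (cases "i \<in> I") (simp_all add: \<phi>_def)
  have "(\<integral>\<^sup>+z. ennreal (norm (coord_proj S z) powr (5/2) * norm (z - coord_proj S z) powr (-7/2) *
    exp (- (norm z)\<^sup>2)) \<partial>lborel) \<le> (\<integral>\<^sup>+z. 8 * (\<Prod>i\<in>Basis. \<phi> i (z \<bullet> i)) \<partial>lborel)"
    by (rule nn_integral_mono_AE[OF bound])
  also have "\<dots> = 8 * (\<integral>\<^sup>+z. (\<Prod>i\<in>Basis. \<phi> i (z \<bullet> i)) \<partial>lborel)"
    by (rule nn_integral_cmult) measurable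
  also have "(\<integral>\<^sup>+z. (\<Prod>i\<in>Basis. \<phi> i (z \<bullet> i)) \<partial>lborel) = (\<Prod>i\<in>(Basis :: 'a set). \<integral>\<^sup>+t. \<phi> i t \<partial>lborel)"
    by (rule nn_integral_lborel_prod) auto
  also have "(\<Prod>i\<in>(Basis :: 'a set). \<integral>\<^sup>+t. \<phi> i t \<partial>lborel) \<noteq> top" 
    using fin by (simp add: ennreal_prod_eq_top less_top)
  then have "8 * (\<Prod>i\<in>(Basis :: 'a set). \<integral>\<^sup>+t. \<phi> i t \<partial>lborel) < \<infinity>"
    by (simp add: ennreal_mult_eq_top_iff less_top[symmetric])
  finally show ?thesis .
qed

text \<open>Convexity in the form of a tangent line at \<open>y\<close>. With \<open>u\<close> and
  \<open>v\<close> the square roots and denominators cleared, the difference of the two sides is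
  \<open>(u - v) ^ 2 * (u + 2 * v)\<close>.\<close>

lemma inverse_sqrt_tangent:
  assumes "x > (0::real)" "y > 0"
  shows "1 / sqrt y - (x - y) / (2 * y * sqrt y) \<le> 1 / sqrt x"
proof -
  define u v where "u = sqrt x" and "v = sqrt y"
  have uv: "u > 0" "v > 0" "x = u\<^sup>2" "y = v\<^sup>2" using assms by (auto simp: u_def v_def)
  have "0 \<le> (u - v)\<^sup>2 * (u + 2 * v)" using uv by simp
  then have "2 * v ^ 2 * u - (u\<^sup>2 - v\<^sup>2) * u \<le> 2 * v ^ 3"
    by (simp add: power2_eq_square power3_eq_cube algebra_simps)
  then have "(2 * v ^ 2 * u - (u\<^sup>2 - v\<^sup>2) * u) / (2 * v ^ 3 * u) \<le> 2 * v ^ 3 / (2 * v ^ 3 * u)"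
    using uv by (intro divide_right_mono) auto
  also have "2 * v ^ 3 / (2 * v ^ 3 * u) = 1 / u" using uv by simp
  also have "(2 * v ^ 2 * u - (u\<^sup>2 - v\<^sup>2) * u) / (2 * v ^ 3 * u) = 1 / v - (u\<^sup>2 - v\<^sup>2) / (2 * v\<^sup>2 * v)"
    using uv by (simp add: field_simps power2_eq_square power3_eq_cube)
  finally show ?thesis using uv by (simp add: u_def[symmetric] v_def[symmetric])
qed

text \<open>\<open>\<delta> ^ 2\<close> is the mean of \<open>(\<delta> / 2) ^ 2\<close> and 1 with
  weights proportional to \<open>1 - \<delta> ^ 2\<close> and \<open>3 / 4 * \<delta> ^ 2\<close>,
  whose sum is \<open>1 - \<delta> ^ 2 / 4\<close>. The point \<open>\<delta> / 2\<close> replaces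
  0, where the root of \<open>b\<close> may vanish.\<close>

lemma inverse_sqrt_convex:
  assumes ab: "a \<ge> 0" "b \<ge> 0" "a + b > (0::real)" and \<delta>: "0 < \<delta>" "\<delta> < 1"
  shows "(1 - \<delta>\<^sup>2 / 4) * (1 / sqrt (\<delta>\<^sup>2 * a + b)) \<le>
    (1 - \<delta>\<^sup>2) * (1 / sqrt ((\<delta> / 2)\<^sup>2 * a + b)) + 3 / 4 * \<delta>\<^sup>2 * (1 / sqrt (1\<^sup>2 * a + b))"
proof -
  have pos: "p * a + b > 0" if "p > 0" for p
    using ab that by (cases "a = 0") (auto intro: add_pos_nonneg)
  define y where "y = \<delta>\<^sup>2 * a + b"
  define D where "D = 1 / (2 * y * sqrt y)"
  have \<delta>2: "0 < \<delta>\<^sup>2" "\<delta>\<^sup>2 < 1" using \<delta> by (auto simp: power_less_one_iff)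
  have y: "y > 0" unfolding y_def using \<delta>2 by (intro pos)
  have 1: "1 / sqrt y - ((\<delta> / 2)\<^sup>2 * a + b - y) * D \<le> 1 / sqrt ((\<delta> / 2)\<^sup>2 * a + b)"
    using inverse_sqrt_tangent[OF pos[of "(\<delta> / 2)\<^sup>2"] y] \<delta> by (simp add: D_def)
  have 2: "1 / sqrt y - (1\<^sup>2 * a + b - y) * D \<le> 1 / sqrt (1\<^sup>2 * a + b)"
    using inverse_sqrt_tangent[OF pos[of "1\<^sup>2"] y] by (simp add: D_def)
  \<comment> \<open>With these weights the first-order terms of the two tangent bounds
    cancel.\<close>
  have "(1 - \<delta>\<^sup>2 / 4) * (1 / sqrt y) =
    (1 - \<delta>\<^sup>2) * (1 / sqrt y - ((\<delta> / 2)\<^sup>2 * a + b - y) * D) + 3 / 4 * \<delta>\<^sup>2 * (1 / sqrt y - (1\<^sup>2 * a + b - y) * D)"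
  proof -
    have "(1 - d / 4) * r = (1 - d) * (r - (d / 4 * a + b - (d * a + b)) * D) + 3 / 4 * d * (r - (a + b - (d * a + b)) * D)"
      for d r :: real by (simp add: field_simps)
    from this[of "\<delta>\<^sup>2" "1 / sqrt y"] show ?thesis by (simp add: y_def power_divide)
  qed
  also have "\<dots> \<le> (1 - \<delta>\<^sup>2) * (1 / sqrt ((\<delta> / 2)\<^sup>2 * a + b)) + 3 / 4 * \<delta>\<^sup>2 * (1 / sqrt (1\<^sup>2 * a + b))"
    using \<delta>2 by (intro add_mono mult_left_mono 1 2) auto
  finally show ?thesis by (simp add: y_def)
qed

section \<open>Radial functions of direct sums\<close>

text \<open>\<open>GREATEST\<close> is informative only if a maximum is attained: for
  \<open>x \<noteq> 0\<close> and compact \<open>K\<close> the admissible factors form a compact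
  set, nonempty because it contains 0.\<close>

lemma radial_greatest:
  fixes K :: "'a::euclidean_space set"
  assumes "compact K" "0 \<in> K" "x \<noteq> 0"
  shows radial_mem: "radial K x *\<^sub>R x \<in> K" and radial_ge: "a *\<^sub>R x \<in> K \<Longrightarrow> a \<le> radial K x"
proof -
  define E where "E = {a. a *\<^sub>R x \<in> K}"
  have "closed E"
  proof -
    have "closed ((\<lambda>a::real. a *\<^sub>R x) -` K)"
      using compact_imp_closed[OF assms(1)] by (intro closed_vimage continuous_intros)
    then show ?thesis by (simp add: E_def vimage_def)
  qed
  moreover have "bounded E"
  proof -
    obtain R where "\<And>y. y \<in> K \<Longrightarrow> norm y \<le> R" using compact_imp_bounded[OF assms(1)] by (auto simp: bounded_iff)
    then have "\<bar>a\<bar> * norm x \<le> R" if "a \<in> E" for a using that by (force simp: E_def)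
    then show ?thesis using assms(3) by (auto simp: bounded_iff pos_le_divide_eq intro!: exI[of _ "R / norm x"])
  qed
  ultimately have "compact E" by (simp add: compact_eq_bounded_closed)
  moreover have "0 \<in> E" using assms(2) by (simp add: E_def)
  ultimately obtain m where m: "m \<in> E" "\<And>a. a \<in> E \<Longrightarrow> a \<le> m" using compact_attains_sup[of E] by auto
  then have "radial K x = m"
    unfolding radial_def by (intro Greatest_equality) (auto simp: E_def)
  with m show "radial K x *\<^sub>R x \<in> K" "a *\<^sub>R x \<in> K \<Longrightarrow> a \<le> radial K x" by (auto simp: E_def)
qed

lemma radial_scale:
  fixes K :: "'a::euclidean_space set"
  assumes "compact K" "0 \<in> K" "x \<noteq> 0" "r > 0"
  shows "radial K (r *\<^sub>R x) = radial K x / r"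
proof (rule antisym)
  have rx: "r *\<^sub>R x \<noteq> 0" using assms by simp
  have "(radial K (r *\<^sub>R x) * r) *\<^sub>R x \<in> K" using radial_mem[OF assms(1,2) rx] by simp
  then show "radial K (r *\<^sub>R x) \<le> radial K x / r"
    using radial_ge[OF assms(1-3)] assms(4) by (simp add: pos_le_divide_eq)
  have "(radial K x / r) *\<^sub>R (r *\<^sub>R x) \<in> K" using radial_mem[OF assms(1-3)] assms(4) by simp
  then show "radial K x / r \<le> radial K (r *\<^sub>R x)" by (rule radial_ge[OF assms(1,2) rx])
qed

text \<open>Homogeneity spreads continuity from the sphere to all nonzero vectors. At the origin
  every factor is admissible and \<open>GREATEST\<close> is unspecified, so that point is treated as
  an exception.\<close>

lemma borel_measurable_radial:
  fixes K :: "'a::euclidean_space set"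
  assumes "compact K" "0 \<in> K" "continuous_on (sphere 0 1) (radial K)"
  shows "radial K \<in> borel_measurable borel"
proof (rule borel_measurable_continuous_countable_exceptions[of "{0}"])
  have "continuous_on (- {0}) (\<lambda>x. radial K (sgn x) / norm x)"
    by (intro continuous_on_divide continuous_on_compose2[OF assms(3)] continuous_intros) (auto simp: norm_sgn split: if_splits)
  moreover have "radial K (sgn x) / norm x = radial K x" if "x \<noteq> 0" for x
    using radial_scale[OF assms(1,2), of x "inverse (norm x)"] that
    by (simp add: sgn_div_norm)
  ultimately show "continuous_on (- {0}) (radial K)" by (subst (asm) continuous_on_cong[OF refl]) auto
qed simp

lemma radial_bounds:
  fixes K :: "'a::euclidean_space set"
  assumes K: "compact K" "x \<noteq> 0" and c: "c > 0" "cball 0 c \<subseteq> K" and R: "\<forall>y\<in>K. norm y \<le> R"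
  shows "c / norm x \<le> radial K x" "radial K x \<le> R / norm x" "0 < radial K x"
proof -
  have 0: "0 \<in> K" using c by auto
  have "(c / norm x) *\<^sub>R x \<in> K" using c K(2) by (intro subsetD[OF c(2)]) auto
  from radial_ge[OF K(1) 0 K(2) this] show 1: "c / norm x \<le> radial K x" .
  moreover have "c / norm x > 0" using c K(2) by simp
  ultimately show pos: "0 < radial K x" by linarith
  show "radial K x \<le> R / norm x"
    using R[rule_format, OF radial_mem[OF K(1) 0 K(2)]] pos K(2) by (simp add: pos_le_divide_eq)
qed

text \<open>Components in a direct sum are unique, so membership decouples. This is the source of
  the maximum in the formula for the norm of \<open>K\<close>.\<close>

lemma direct_sum_mem_iff:
  assumes "is_direct_sum K A B" "a \<in> span A" "b \<in> span B"
  shows "a + b \<in> K \<longleftrightarrow> a \<in> A \<and> b \<in> B"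
proof
  assume "a + b \<in> K"
  then obtain a' b' where ab: "a' \<in> A" "b' \<in> B" "a + b = a' + b'"
    using assms by (auto simp: is_direct_sum_def)
  have "a - a' = b' - b" using ab(3) by (simp add: algebra_simps)
  moreover have "a - a' \<in> span A" using assms ab by (intro span_diff) (auto intro: span_base)
  moreover have "b' - b \<in> span B" using assms ab by (intro span_diff) (auto intro: span_base)
  ultimately have "b' - b \<in> span A \<inter> span B" by simp
  with assms(1) have "b' - b = 0" unfolding is_direct_sum_def by blast
  then have "b' - b = 0" "a - a' = 0" using \<open>a - a' = b' - b\<close> by simp_all
  then show "a \<in> A \<and> b \<in> B" using ab by simp
qed (use assms in \<open>auto simp: is_direct_sum_def\<close>)

text \<open>Let \<open>l = radial K b\<close>. If \<open>l * norm a \<le> c\<close>, then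
  \<open>l *\<^sub>R a\<close> lies in the ball inside \<open>K\<close>, and adding \<open>a\<close>
  costs nothing. Otherwise \<open>l * (norm a / c)\<close> exceeds 1, so \<open>l\<close> itself may
  be multiplied by its power 5/2; bounding \<open>l\<close> by \<open>R / norm b\<close> gives the
  exponent 7/2.\<close>

lemma direct_sum_radial:
  fixes K :: "'a::euclidean_space set"
  assumes K: "compact K" and c: "c > 0" "cball 0 c \<subseteq> K" and R: "\<forall>y\<in>K. norm y \<le> R"
    and sum: "is_direct_sum K A B" and a: "a \<in> span A" and b: "b \<in> span B" "b \<noteq> 0"
  shows "radial K (a + b) \<le> radial K b"
    and "radial K b \<le> radial K (a + b) + (R / norm b) powr (7/2) * (norm a / c) powr (5/2)"
proof -
  note mem = direct_sum_mem_iff[OF sum]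
  have 0: "0 \<in> K" using c by auto
  have A0: "0 \<in> A" and B0: "0 \<in> B" using mem[OF span_zero span_zero] 0 by auto
  have ab: "a + b \<noteq> 0"
  proof
    assume "a + b = 0"
    then have "b = - a" by (simp add: eq_neg_iff_add_eq_0 add.commute)
    then have "b \<in> span A \<inter> span B" using a b by (auto intro: span_neg)
    with sum b show False by (auto simp: is_direct_sum_def)
  qed
  have scale: "t *\<^sub>R (a + b) \<in> K \<longleftrightarrow> t *\<^sub>R a \<in> A \<and> t *\<^sub>R b \<in> B" for t
    using mem[OF span_scale[OF a] span_scale[OF b(1)], of t t] by (simp add: scaleR_add_right)
  have scale_b: "t *\<^sub>R b \<in> K \<longleftrightarrow> t *\<^sub>R b \<in> B" for t
    using mem[OF span_zero span_scale[OF b(1)], of t] A0 by simp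
  have scale_a: "t *\<^sub>R a \<in> K \<longleftrightarrow> t *\<^sub>R a \<in> A" for t
    using mem[OF span_scale[OF a] span_zero, of t] B0 by simp
  have "radial K (a + b) *\<^sub>R b \<in> K"
    using radial_mem[OF K 0 ab] unfolding scale scale_b by simp
  then show "radial K (a + b) \<le> radial K b" by (rule radial_ge[OF K 0 b(2)])
  define l where "l = radial K b"
  have l: "0 < l" "l \<le> R / norm b" using radial_bounds[OF K b(2) c R] by (auto simp: l_def)
  show "radial K b \<le> radial K (a + b) + (R / norm b) powr (7/2) * (norm a / c) powr (5/2)"
  proof (cases "l * norm a \<le> c")
    case True
    then have "l *\<^sub>R a \<in> K" using l by (intro subsetD[OF c(2)]) auto
    moreover have "l *\<^sub>R b \<in> K" unfolding l_def by (rule radial_mem[OF K 0 b(2)])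
    ultimately have "l *\<^sub>R (a + b) \<in> K" unfolding scale scale_a scale_b by simp
    then have "l \<le> radial K (a + b)" by (rule radial_ge[OF K 0 ab])
    moreover have "0 \<le> (R / norm b) powr (7/2) * (norm a / c) powr (5/2)" by simp
    ultimately show ?thesis unfolding l_def by linarith
  next
    case False
    then have "1 \<le> l * (norm a / c)" using c by (simp add: field_simps)
    then have "1 \<le> (l * (norm a / c)) powr (5/2)" by (intro ge_one_powr_ge_zero) auto
    then have "l * 1 \<le> l * (l * (norm a / c)) powr (5/2)" using l by (intro mult_left_mono) auto
    also have "\<dots> = l powr 1 * (l powr (5/2) * (norm a / c) powr (5/2))"
      using l c by (subst powr_mult) auto
    also have "\<dots> = l powr (1 + 5/2) * (norm a / c) powr (5/2)" unfolding powr_add by simp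
    also have "\<dots> \<le> (R / norm b) powr (7/2) * (norm a / c) powr (5/2)"
      using l by (intro mult_right_mono) (auto intro!: powr_mono2)
    finally have "l \<le> (R / norm b) powr (7/2) * (norm a / c) powr (5/2)" by simp
    moreover have "0 < radial K (a + b)" by (rule radial_bounds[OF K ab c R])
    ultimately show ?thesis unfolding l_def by linarith
  qed
qed

section \<open>Comparing the two sides of the identity for small stretch factors\<close>

lemma direct_sum_not_intersection_body:
  fixes K A B :: "'a::euclidean_space set"
  assumes sum: "is_direct_sum K A B" and dA: "dim A \<ge> 1" and dB: "dim B \<ge> 4"
  shows "\<not> intersection_body K"
proof
  assume "intersection_body K"
  then obtain \<mu> where star: "star_body K"
    and \<mu>: "sets \<mu> = sets (restrict_space borel (sphere (0::'a) 1))" "finite_measure \<mu>"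
    and radon: "\<And>g. continuous_on (sphere 0 1) g \<Longrightarrow>
      (LINT \<xi>|sphere_measure UNIV. radial K \<xi> * g \<xi>) = (LINT \<xi>|\<mu>. spherical_radon g \<xi>)"
    by (auto simp: intersection_body_def)
  interpret finite_measure \<mu> by fact
  have K: "compact K" and int: "0 \<in> interior K" and contK: "continuous_on (sphere 0 1) (radial K)"
    using star by (auto simp: star_body_def)
  obtain c where c: "c > 0" "cball 0 c \<subseteq> K"
    using int by (auto simp: mem_interior_cball)
  then have 0: "0 \<in> K" by auto
  obtain R where R: "\<forall>y\<in>K. norm y \<le> R" using compact_imp_bounded[OF K] by (auto simp: bounded_iff)
  note bounds = radial_bounds[OF K _ c R]
  have Rc: "R \<ge> c"
  proof -
    obtain b :: 'a where "b \<in> Basis" using nonempty_Basis by blast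
    then have "c *\<^sub>R b \<in> cball 0 c" using c by auto
    with c(2) R show ?thesis using \<open>b \<in> Basis\<close> c(1) by fastforce
  qed
  have decomp: "{u + v | u v. u \<in> span A \<and> v \<in> span B} = UNIV" "span A \<inter> span B = {0}"
    using sum by (simp_all only: is_direct_sum_def)
  obtain S :: "'a set" and L :: "'a \<Rightarrow> 'a" where S: "S \<subseteq> Basis" "card S = dim (span A)" "card (Basis - S) = dim (span B)"
    and L: "linear L" "inj L" and LA: "\<And>z. L (coord_proj S z) \<in> span A"
    and LB: "\<And>z. L (z - coord_proj S z) \<in> span B"
    by (rule direct_sum_coordinates[OF subspace_span subspace_span decomp]) (rule that)
  define P where "P = coord_proj S"
  define E where "E = coord_stretch S"
  have Sd: "card S \<ge> 1" "card (Basis - S) \<ge> 4" using S dA dB by auto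
  have n: "DIM('a) \<ge> 2"
    using Sd card_mono[OF finite_Basis, of "Basis - S"] by auto
  obtain N where N: "linear N" "\<And>x. L (N x) = x" "\<And>x. N (L x) = x"
    using linear_injective_isomorphism[OF L] by blast
  obtain m where m: "m > 0" "\<And>x. m * norm x \<le> norm (L x)" using linear_inj_bounded_below_pos[OF L] by blast
  obtain M where M: "M > 0" "\<And>x. norm (L x) \<le> M * norm x"
    using linear_bounded_pos[OF L(1)] by (metis mult.commute)
  have [measurable]: "L \<in> borel_measurable borel" "P \<in> borel_measurable borel" "E s \<in> borel_measurable borel" for s
    using L(1) linear_coord_proj[of S] linear_coord_stretch[of S s]
    by (auto simp: P_def E_def intro!: borel_measurable_continuous_onI linear_continuous_on simp: linear_linear)
  have \<rho>[measurable]: "radial K \<in> borel_measurable borel" by (rule borel_measurable_radial[OF K 0 contK])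

  define C where "C = enn2real gauss_int ^ (DIM('a) - 1)"
  define I where "I = (\<lambda>s. LINT \<xi>|\<mu>. 1 / norm (E s (adjoint L \<xi>)))"
  define J where "J = (\<lambda>s. \<integral>\<^sup>+z. ennreal (radial K (L (E s z)) * exp (- (norm z)\<^sup>2)) \<partial>lborel)"
  \<comment> \<open>The value at \<open>s = 0\<close> is written out directly, because
    \<open>E 0\<close> is singular and the Radon identity does not reach it.\<close>
  define J0 where "J0 = (\<integral>\<^sup>+z. ennreal (radial K (L (z - P z)) * exp (- (norm z)\<^sup>2)) \<partial>lborel)"
  define H where "H = (\<integral>\<^sup>+z. ennreal (norm (P z) powr (5/2) * norm (z - P z) powr (-7/2) * exp (- (norm z)\<^sup>2)) \<partial>lborel)"
  have C0: "C \<ge> 0" by (simp add: C_def)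
  have H: "H < \<infinity>" unfolding H_def P_def by (rule singular_gauss_finite[OF S(1) Sd(2)])

  \<comment> \<open>The identity is applied to \<open>T = L o E s\<close>. Its inverse is
    \<open>E (1 / s) o N\<close>, and its transpose is \<open>E s o adjoint L\<close> since
    \<open>E s\<close> is self-adjoint.\<close>
  have J_eq: "J s = ennreal (C * I s)" if "s > 0" for s
    unfolding J_def C_def I_def
  proof (rule radon_identity[OF n, where N = "\<lambda>x. E (1 / s) (N x)"])
    show "linear (\<lambda>z. L (E s z))" "linear (\<lambda>x. E (1 / s) (N x))"
      using linear_compose[OF linear_coord_stretch L(1)] linear_compose[OF N(1) linear_coord_stretch]
      by (auto simp: E_def o_def)
    show "L (E s (E (1 / s) (N x))) = x" "E (1 / s) (N (L (E s x))) = x" for x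
      using that by (simp_all add: E_def coord_stretch_inverse[OF S(1)] N)
    show "L (E s x) \<bullet> y = x \<bullet> E s (adjoint L y)" for x y
      by (simp add: adjoint_works[OF L(1), symmetric] E_def coord_stretch_adjoint)
    show "0 \<le> radial K x" if "x \<noteq> 0" for x using bounds(3)[OF that] by simp
    show "radial K (r *\<^sub>R x) = radial K x / r" if "r > 0" "x \<noteq> 0" for r x
      using radial_scale[OF K 0 that(2,1)] .
  qed (use \<rho> contK \<mu> radon in auto)

  have adj_inj: "adjoint L \<xi> = 0 \<Longrightarrow> \<xi> = 0" for \<xi>
    using adjoint_works[OF L(1), of "N \<xi>" \<xi>] by (simp add: N)
  have norm_E: "norm (E s w) = sqrt (s\<^sup>2 * (norm (P w))\<^sup>2 + (norm (w - P w))\<^sup>2)" for s w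
    using norm_coord_stretch[OF S(1), of s w] by (metis E_def P_def norm_ge_zero real_sqrt_unique)
  have integrable: "integrable \<mu> (\<lambda>\<xi>. 1 / norm (E s (adjoint L \<xi>)))" if "s > 0" for s
  proof -
    have lin: "linear (\<lambda>\<xi>. E s (adjoint L \<xi>))"
      using linear_compose[OF adjoint_linear[OF L(1)] linear_coord_stretch] by (simp add: E_def o_def)
    moreover have "inj (\<lambda>\<xi>. E s (adjoint L \<xi>))"
    proof (subst linear_injective_0[OF lin], intro allI impI)
      fix \<xi> assume "E s (adjoint L \<xi>) = 0"
      then have "E (1 / s) (E s (adjoint L \<xi>)) = 0" by (simp add: E_def linear_0[OF linear_coord_stretch])
      then show "\<xi> = 0" using that adj_inj by (simp add: E_def coord_stretch_inverse[OF S(1)])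
    qed
    ultimately obtain e where e: "e > 0" "\<And>\<xi>. e * norm \<xi> \<le> norm (E s (adjoint L \<xi>))"
      using linear_inj_bounded_below_pos by blast
    have "norm (1 / norm (E s (adjoint L \<xi>))) \<le> 1 / e" if "\<xi> \<in> space \<mu>" for \<xi>
    proof -
      have "norm \<xi> = 1" using that sets_eq_imp_space_eq[OF \<mu>(1)] by (auto simp: space_restrict_space)
      then have "e \<le> norm (E s (adjoint L \<xi>))" using e(2)[of \<xi>] by simp
      with e(1) show ?thesis by (simp add: frac_le)
    qed
    moreover have "(\<lambda>\<xi>. 1 / norm (E s (adjoint L \<xi>))) \<in> borel_measurable \<mu>"
    proof -
      have [measurable]: "(\<lambda>\<xi>. E s (adjoint L \<xi>)) \<in> borel_measurable borel"
        using lin by (auto intro!: borel_measurable_continuous_onI linear_continuous_on simp: linear_linear)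
      have "(\<lambda>\<xi>. 1 / norm (E s (adjoint L \<xi>))) \<in> borel_measurable borel" by measurable
      then show ?thesis
        by (subst measurable_cong_sets[OF \<mu>(1) refl]) (rule measurable_restrict_space1)
    qed
    ultimately show ?thesis by (intro integrable_const_bound[of _ "1 / e"] AE_I2) auto
  qed
  have convex: "(1 - \<delta>\<^sup>2 / 4) * (C * I \<delta>) \<le> (1 - \<delta>\<^sup>2) * (C * I (\<delta> / 2)) + 3 / 4 * \<delta>\<^sup>2 * (C * I 1)"
    if \<delta>: "0 < \<delta>" "\<delta> < 1" for \<delta>
  proof -
    have "(1 - \<delta>\<^sup>2 / 4) * I \<delta> = (LINT \<xi>|\<mu>. (1 - \<delta>\<^sup>2 / 4) * (1 / norm (E \<delta> (adjoint L \<xi>))))"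
      unfolding I_def by (rule integral_mult_right_zero[symmetric])
    also have "\<dots> \<le> (LINT \<xi>|\<mu>. (1 - \<delta>\<^sup>2) * (1 / norm (E (\<delta> / 2) (adjoint L \<xi>))) +
        3 / 4 * \<delta>\<^sup>2 * (1 / norm (E 1 (adjoint L \<xi>))))"
    proof (intro integral_mono integrable_mult_right Bochner_Integration.integrable_add integrable)
      fix \<xi> assume "\<xi> \<in> space \<mu>"
      then have "norm \<xi> = 1" using sets_eq_imp_space_eq[OF \<mu>(1)] by (auto simp: space_restrict_space)
      then have w: "adjoint L \<xi> \<noteq> 0" using adj_inj by force
      define w where "w = adjoint L \<xi>"
      have "P w \<noteq> 0 \<or> w - P w \<noteq> 0" using w by (auto simp: w_def)
      then have "(norm (P w))\<^sup>2 + (norm (w - P w))\<^sup>2 > 0"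
        by (simp add: sum_power2_gt_zero_iff)
      then show "(1 - \<delta>\<^sup>2 / 4) * (1 / norm (E \<delta> (adjoint L \<xi>))) \<le>
        (1 - \<delta>\<^sup>2) * (1 / norm (E (\<delta> / 2) (adjoint L \<xi>))) + 3 / 4 * \<delta>\<^sup>2 * (1 / norm (E 1 (adjoint L \<xi>)))"
        unfolding norm_E w_def[symmetric] by (intro inverse_sqrt_convex \<delta>) auto
    qed (use \<delta> in auto)
    also have "\<dots> = (LINT \<xi>|\<mu>. (1 - \<delta>\<^sup>2) * (1 / norm (E (\<delta> / 2) (adjoint L \<xi>)))) +
        (LINT \<xi>|\<mu>. 3 / 4 * \<delta>\<^sup>2 * (1 / norm (E 1 (adjoint L \<xi>))))"
      using \<delta> by (intro Bochner_Integration.integral_add integrable_mult_right integrable) auto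
    also have "\<dots> = (1 - \<delta>\<^sup>2) * I (\<delta> / 2) + 3 / 4 * \<delta>\<^sup>2 * I 1"
      unfolding I_def by (simp only: integral_mult_right_zero)
    finally have "C * ((1 - \<delta>\<^sup>2 / 4) * I \<delta>) \<le> C * ((1 - \<delta>\<^sup>2) * I (\<delta> / 2) + 3 / 4 * \<delta>\<^sup>2 * I 1)"
      by (rule mult_left_mono[OF _ C0])
    then show ?thesis by (simp add: algebra_simps)
  qed

  have "Basis - S \<noteq> {}" using Sd(2) by (metis card.empty not_numeral_le_zero)
  then obtain k where k: "k \<in> Basis - S" by blast
  have "AE z in lborel. z \<bullet> k \<noteq> 0" using k by (intro AE_lborel_inner_nonzero) auto
  then have AE_nz: "AE z in lborel. L (z - P z) \<noteq> 0"
  proof eventually_elim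
    fix z assume "z \<bullet> k \<noteq> 0"
    then have "(z - P z) \<bullet> k \<noteq> 0"
      using k by (simp add: P_def inner_diff_left coord_proj_inner_Basis[OF S(1)])
    then have "z - P z \<noteq> 0" by auto
    then show "L (z - P z) \<noteq> 0" using N(3) linear_0[OF N(1)] by metis
  qed
  have LE: "L (E s z) = s *\<^sub>R L (P z) + L (z - P z)" for s z
    by (simp add: E_def P_def coord_stretch_def linear_add[OF L(1)] linear_scale[OF L(1)])
  have LA': "s *\<^sub>R L (P z) \<in> span A" for s z by (simp add: P_def LA span_scale)
  have LB': "L (z - P z) \<in> span B" for z by (simp add: P_def LB)
  note rad = direct_sum_radial[OF K c R sum LA' LB']

  have AE_le: "AE z in lborel. ennreal (radial K (L (E s z)) * exp (- (norm z)\<^sup>2)) \<le>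
      ennreal (radial K (L (z - P z)) * exp (- (norm z)\<^sup>2))" for s
    using AE_nz by eventually_elim (auto simp: LE intro!: ennreal_leI mult_right_mono rad(1))
  have J_le: "J s \<le> J0" for s
    unfolding J_def J0_def by (rule nn_integral_mono_AE[OF AE_le])
  \<comment> \<open>Collects the distortion of \<open>L\<close>:
    \<open>m * norm y \<le> norm (L y)\<close> enlarges the singular factor and
    \<open>norm (L x) \<le> M * norm x\<close> the other one.\<close>
  define F where "F = (R / m) powr (7/2) * (M / c) powr (5/2)"
  have F0: "F \<ge> 0" by (simp add: F_def)
  have J0_le: "J0 \<le> J s + ennreal (F * s powr (5/2)) * H" if "s > 0" for s
  proof -
    have "J0 \<le> (\<integral>\<^sup>+z. ennreal (radial K (L (E s z)) * exp (- (norm z)\<^sup>2)) + ennreal (F * s powr (5/2)) *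
      ennreal (norm (P z) powr (5/2) * norm (z - P z) powr (-7/2) * exp (- (norm z)\<^sup>2)) \<partial>lborel)"
      unfolding J0_def
    proof (rule nn_integral_mono_AE)
      show "AE z in lborel. ennreal (radial K (L (z - P z)) * exp (- (norm z)\<^sup>2)) \<le>
        ennreal (radial K (L (E s z)) * exp (- (norm z)\<^sup>2)) + ennreal (F * s powr (5/2)) *
        ennreal (norm (P z) powr (5/2) * norm (z - P z) powr (-7/2) * exp (- (norm z)\<^sup>2))"
        using AE_nz
      proof eventually_elim
        fix z assume z: "L (z - P z) \<noteq> 0"
        define y where "y = z - P z"
        have y: "y \<noteq> 0" using z linear_0[OF L(1)] by (auto simp: y_def)
        have nz: "L (E s z) \<noteq> 0"
        proof
          assume "L (E s z) = 0"
          then have "L (z - P z) = - (s *\<^sub>R L (P z))" by (simp add: LE eq_neg_iff_add_eq_0 add.commute)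
          then have "L (z - P z) \<in> span A \<inter> span B" using LA'[of s z] LB'[of z] by (simp add: span_neg)
          with sum z show False by (auto simp: is_direct_sum_def)
        qed
        have "radial K (L y) \<le> radial K (L (E s z)) + (R / norm (L y)) powr (7/2) * (norm (s *\<^sub>R L (P z)) / c) powr (5/2)"
          using rad(2)[OF z, of s z] by (simp add: LE y_def)
        also have "(R / norm (L y)) powr (7/2) * (norm (s *\<^sub>R L (P z)) / c) powr (5/2) \<le>
          (R / (m * norm y)) powr (7/2) * (s * (M * norm (P z)) / c) powr (5/2)"
        proof (intro mult_mono powr_mono2)
          show "R / norm (L y) \<le> R / (m * norm y)" using Rc c(1) m y by (intro divide_left_mono mult_pos_pos) (auto simp: y_def z)
          show "norm (s *\<^sub>R L (P z)) / c \<le> s * (M * norm (P z)) / c"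
            using that c(1) M(2)[of "P z"] by (intro divide_right_mono) auto
        qed (use Rc c(1) in auto)
        also have "\<dots> = F * s powr (5/2) * (norm (P z) powr (5/2) * norm y powr (-7/2))"
        proof -
          have 1: "(R / (m * norm y)) powr (7/2) = (R / m) powr (7/2) * norm y powr (-7/2)"
          proof -
            have "R / (m * norm y) = (R / m) * inverse (norm y)" by (simp add: divide_inverse)
            moreover have "((R / m) * inverse (norm y)) powr (7/2) = (R / m) powr (7/2) * inverse (norm y) powr (7/2)"
              by (rule powr_mult)
            moreover have "inverse (norm y) powr (7/2) = norm y powr (- (7/2))"
              by (simp only: powr_minus inverse_powr)
            ultimately show ?thesis by simp
          qed
          have 2: "(s * (M * norm (P z)) / c) powr (5/2) = s powr (5/2) * (M / c) powr (5/2) * norm (P z) powr (5/2)"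
          proof -
            have "s * (M * norm (P z)) / c = (s * (M / c)) * norm (P z)" by simp
            moreover have "((s * (M / c)) * norm (P z)) powr (5/2) = (s * (M / c)) powr (5/2) * norm (P z) powr (5/2)"
              by (rule powr_mult)
            moreover have "(s * (M / c)) powr (5/2) = s powr (5/2) * (M / c) powr (5/2)"
              by (rule powr_mult)
            ultimately show ?thesis by (simp only:)
          qed
          show ?thesis unfolding 1 2 F_def by (simp add: mult_ac)
        qed
        finally have "radial K (L y) * exp (- (norm z)\<^sup>2) \<le>
          (radial K (L (E s z)) + F * s powr (5/2) * (norm (P z) powr (5/2) * norm y powr (-7/2))) * exp (- (norm z)\<^sup>2)"
          by (intro mult_right_mono) auto
        then have "ennreal (radial K (L y) * exp (- (norm z)\<^sup>2)) \<le> ennreal (radial K (L (E s z)) * exp (- (norm z)\<^sup>2) +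
          F * s powr (5/2) * (norm (P z) powr (5/2) * norm y powr (-7/2) * exp (- (norm z)\<^sup>2)))"
          by (intro ennreal_leI) (simp add: algebra_simps)
        also have "\<dots> = ennreal (radial K (L (E s z)) * exp (- (norm z)\<^sup>2)) + ennreal (F * s powr (5/2)) *
          ennreal (norm (P z) powr (5/2) * norm y powr (-7/2) * exp (- (norm z)\<^sup>2))"
          using F0 less_imp_le[OF bounds(3)[OF nz]] by (subst ennreal_plus) (auto simp: ennreal_mult)
        finally show "ennreal (radial K (L (z - P z)) * exp (- (norm z)\<^sup>2)) \<le>
          ennreal (radial K (L (E s z)) * exp (- (norm z)\<^sup>2)) + ennreal (F * s powr (5/2)) *
          ennreal (norm (P z) powr (5/2) * norm (z - P z) powr (-7/2) * exp (- (norm z)\<^sup>2))"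
          by (simp add: y_def)
      qed
    qed
    also have "\<dots> = J s + ennreal (F * s powr (5/2)) * H"
      unfolding J_def H_def by (subst nn_integral_add) (auto simp: nn_integral_cmult)
    finally show ?thesis .
  qed
  define h where "h = enn2real H"
  have h: "H = ennreal h" "h \<ge> 0" using H by (simp_all add: h_def)
  have I0: "I s \<ge> 0" for s unfolding I_def by (intro integral_nonneg_AE AE_I2) auto
  \<comment> \<open>\<open>J 1\<close> is finite because the Radon identity expresses it as a real
    number, and \<open>J0\<close> exceeds it by at most a multiple of \<open>H\<close>.\<close>
  have "J0 < \<infinity>"
    using J0_le[of 1] F0 h by (auto simp: J_eq ennreal_mult[symmetric] ennreal_plus[symmetric]
      simp del: ennreal_plus intro: le_less_trans)
  then obtain j0 where j0: "J0 = ennreal j0" "j0 \<ge> 0" by (cases J0) auto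
  have I_le: "C * I s \<le> j0" if "s > 0" for s
    using J_le[of s] that j0 by (simp add: J_eq)
  have I_ge: "j0 \<le> C * I s + F * s powr (5/2) * h" if "s > 0" for s
  proof -
    have "ennreal j0 \<le> ennreal (C * I s + F * s powr (5/2) * h)"
      using J0_le[OF that] C0 I0 F0 h by (simp add: J_eq[OF that] j0 ennreal_mult ennreal_plus)
    then show ?thesis using C0 I0 F0 h by (subst (asm) ennreal_le_iff) auto
  qed

  have strict: "C * I 1 < j0"
  proof -
    have "J 1 < J0"
      unfolding J_def J0_def
    proof (rule nn_integral_less)
      show "(\<integral>\<^sup>+z. ennreal (radial K (L (E 1 z)) * exp (- (norm z)\<^sup>2)) \<partial>lborel) \<noteq> \<infinity>"
        using J_eq[of 1] by (simp add: J_def)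
      show "AE z in lborel. ennreal (radial K (L (E 1 z)) * exp (- (norm z)\<^sup>2)) \<le>
        ennreal (radial K (L (z - P z)) * exp (- (norm z)\<^sup>2))"
        by (rule AE_le)
      show "\<not> (AE z in lborel. ennreal (radial K (L (z - P z)) * exp (- (norm z)\<^sup>2)) \<le>
        ennreal (radial K (L (E 1 z)) * exp (- (norm z)\<^sup>2)))"
      proof
        assume ae: "AE z in lborel. ennreal (radial K (L (z - P z)) * exp (- (norm z)\<^sup>2)) \<le>
          ennreal (radial K (L (E 1 z)) * exp (- (norm z)\<^sup>2))"
        \<comment> \<open>On \<open>U\<close> the upper bound \<open>R / norm (L z)\<close> for the
          radial function at \<open>L z\<close> is below the lower bound
          \<open>c / norm (L (z - P z))\<close> at \<open>L (z - P z)\<close>. A basis vector from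
          \<open>S\<close> lies in this open set, since its second component is 0.\<close>
        define U where "U = {z. R * norm (L (z - P z)) < c * norm (L z)}"
        have contL: "continuous_on UNIV L" "continuous_on UNIV P"
          using L(1) linear_coord_proj[of S] by (auto simp: P_def linear_continuous_on linear_linear)
        have "open U" unfolding U_def
          by (intro open_Collect_less continuous_intros continuous_on_compose2[OF contL(1)] contL) auto
        moreover have "U \<noteq> {}"
        proof -
          have "S \<noteq> {}" using Sd(1) by auto
          then obtain i where i: "i \<in> S" by blast
          then have iB: "i \<in> Basis" using S by auto
          have "P i = i"
            by (rule euclidean_eqI) (auto simp: P_def coord_proj_inner_Basis[OF S(1)] inner_Basis i iB)
          moreover have "L i \<noteq> 0" using N(3)[of i] linear_0[OF N(1)] iB by force
          ultimately have "i \<in> U" using c(1) by (simp add: U_def linear_0[OF L(1)])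
          then show ?thesis by auto
        qed
        moreover have "AE z in lborel. z \<notin> U"
          using ae AE_nz
        proof eventually_elim
          fix z assume le: "ennreal (radial K (L (z - P z)) * exp (- (norm z)\<^sup>2)) \<le>
            ennreal (radial K (L (E 1 z)) * exp (- (norm z)\<^sup>2))" and nz: "L (z - P z) \<noteq> 0"
          have E1: "E 1 z = z" by (simp add: E_def coord_stretch_def)
          show "z \<notin> U"
          proof
            assume "z \<in> U"
            then have U: "R * norm (L (z - P z)) < c * norm (L z)" by (simp add: U_def)
            moreover have "0 \<le> R * norm (L (z - P z))" using Rc c(1) by simp
            ultimately have Lz: "L z \<noteq> 0" by auto
            have "radial K (L z) \<le> R / norm (L z)" by (rule bounds(2)[OF Lz])
            also have "\<dots> < c / norm (L (z - P z))"
              using U Lz nz by (simp add: divide_simps mult.commute)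
            also have "\<dots> \<le> radial K (L (z - P z))" by (rule bounds(1)[OF nz])
            finally have "radial K (L z) * exp (- (norm z)\<^sup>2) < radial K (L (z - P z)) * exp (- (norm z)\<^sup>2)" by simp
            moreover have nn: "0 \<le> radial K (L z) * exp (- (norm z)\<^sup>2)" using bounds(3)[OF Lz] by simp
            ultimately show False using le unfolding E1 ennreal_le_iff[OF nn] by linarith
          qed
        qed
        ultimately show False
          using emeasure_lborel_open_nonzero[of U] by (auto simp: AE_iff_measurable[OF _ refl])
      qed
    qed measurable
    then show ?thesis using J_eq[of 1] C0 I0[of 1] j0 by (simp add: ennreal_less_iff)
  qed

  text \<open>Convexity gives \<open>3/4 * \<delta>\<^sup>2 * (J0 - J 1) \<le> J0 - J \<delta>\<close>, which is at most a multiple of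
    \<open>\<delta> powr (5/2)\<close>; the substitution \<open>\<delta> = e\<^sup>2\<close> avoids fractional powers.\<close>
  define D where "D = j0 - C * I 1"
  have D: "D > 0" using strict by (simp add: D_def)
  have key: "3 / 4 * D \<le> F * h * e" if e: "0 < e" "e < 1" for e
  proof -
    define \<delta> where "\<delta> = e\<^sup>2"
    have \<delta>: "0 < \<delta>" "\<delta> < 1" using e by (auto simp: \<delta>_def power_less_one_iff)
    have \<delta>2: "0 < \<delta>\<^sup>2" "\<delta>\<^sup>2 < 1" using \<delta> by (auto simp: power_less_one_iff)
    have pw: "\<delta> powr (5/2) = \<delta>\<^sup>2 * e"
    proof -
      have "\<delta> powr (5/2) = (e powr 2) powr (5/2)" using e by (simp add: \<delta>_def powr_numeral)
      also have "\<dots> = e powr 5" by (simp add: powr_powr)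
      also have "\<dots> = e ^ 5" using e by (simp add: powr_numeral)
      also have "\<dots> = \<delta>\<^sup>2 * e" by (simp add: \<delta>_def power_mult[symmetric] power_add[symmetric] eval_nat_numeral)
      finally show ?thesis .
    qed
    define d where "d = j0 - C * I \<delta>"
    have d: "0 \<le> d" "d \<le> F * (\<delta>\<^sup>2 * e) * h" using I_le[OF \<delta>(1)] I_ge[OF \<delta>(1)] pw by (auto simp: d_def)
    \<comment> \<open>Only the upper bound \<open>j0\<close> is used at \<open>\<delta> / 2\<close>;
      this takes the place of passing to the limit at 0.\<close>
    have "(1 - \<delta>\<^sup>2) * (C * I (\<delta> / 2)) \<le> (1 - \<delta>\<^sup>2) * j0"
      using I_le[of "\<delta> / 2"] \<delta> \<delta>2 by (intro mult_left_mono) auto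
    with convex[OF \<delta>] have "(1 - \<delta>\<^sup>2 / 4) * (j0 - d) \<le> (1 - \<delta>\<^sup>2) * j0 + 3 / 4 * \<delta>\<^sup>2 * (j0 - D)"
      by (simp add: d_def D_def)
    then have "3 / 4 * \<delta>\<^sup>2 * D \<le> (1 - \<delta>\<^sup>2 / 4) * d" by (simp add: field_simps)
    also have "\<dots> \<le> 1 * d" using d \<delta>2 by (intro mult_right_mono) auto
    also have "\<dots> \<le> F * (\<delta>\<^sup>2 * e) * h" using d by simp
    finally have "\<delta>\<^sup>2 * (3 / 4 * D) \<le> \<delta>\<^sup>2 * (F * h * e)" by (simp add: mult_ac)
    then show ?thesis using \<delta>2 by (simp only: mult_le_cancel_left_pos)
  qed
  \<comment> \<open>Chosen so that \<open>F * h * e \<le> D / 2 < 3 / 4 * D\<close>. The summand 1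
    keeps the denominator positive when \<open>F * h = 0\<close>, and the minimum with
    \<open>1 / 2\<close> keeps \<open>e\<close> below 1.\<close>
  define e where "e = min (1 / 2) (D / (2 * (F * h + 1)))"
  have Fh: "F * h \<ge> 0" using F0 h by simp
  have e: "0 < e" "e < 1" using D Fh by (auto simp: e_def)
  have "F * h * e \<le> F * h * (D / (2 * (F * h + 1)))"
    using Fh by (intro mult_left_mono) (auto simp: e_def)
  also have "\<dots> \<le> D / 2" using D Fh by (simp add: field_simps)
  finally show False using key[OF e] D by linarith
qed

theorem mainTheorem1:
  fixes K A B :: "(real ^ 'n) set"
  assumes "CARD('n) \<ge> 5"
    and "convex_body K"
    and "origin_symmetric K"
    and "is_direct_sum K A B"
    and "dim A \<ge> 1"
    and "dim B \<ge> 4"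
  shows "\<not> intersection_body K"
  using assms(4-6) by (rule direct_sum_not_intersection_body)

end
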